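(* Let $G$ be a countable discrete infinite amenable group acting continuously on a compact metric space $X$ with metric $d$. Let $\{F_n\}$ be a tempered Følner sequence in $G$ satisfying $\lim_{n\to+\infty}\frac{|F_n|}{\log n}=\infty$, and let $\mu$ be a $G$-invariant Borel probability measure on $X$. If $Y\subset X$ is a ($\mu$-measurable) subset with $\mu(Y)=1$, then $$h_{\mu}(X,G)\le h^B_{top}(Y,\{F_n\}).$$
   Context: Følner sequence: a sequence $\{F_n\}$ of (nonempty) finite subsets of $G$ with $\lim_{n\to\infty}\frac{|F_n\triangle gF_n|}{|F_n|}=0$ for all $g\in G$; $G$ is amenable if such a sequence exists. A Følner sequence $\{F_n\}$ is tempered if there is a constant $C$, independent of $n$, such that $|\bigcup_{k<n}F_k^{-1}F_n|\le C|F_n|$ for every $n$. Bowen ball: for a finite set $F\subset G$, $\varepsilon>0$ and $x\in X$, $B_F(x,\varepsilon)=\{y\in X: d(gx,gy)<\varepsilon \text{ for any } g\in F\}$. Bowen topological entropy: for $Z\subseteq X$, $s\ge 0$, $N\in\mathbb{N}$, $\varepsilon>0$, put $$\mathcal{M}(Z,N,\varepsilon,s,\{F_n\})=\inf\sum_i\exp(-s|F_{n_i}|),$$ where the infimum is over all finite or countable families $\{B_{F_{n_i}}(x_i,\varepsilon)\}$ with $x_i\in X$, $n_i\ge N$ and $\bigcup_i B_{F_{n_i}}(x_i,\varepsilon)\supseteq Z$. This quantity does not decrease as $N$ increases and as $\varepsilon$ decreases; put $\mathcal{M}(Z,\varepsilon,s,\{F_n\})=\lim_{N\to+\infty}\mathcal{M}(Z,N,\varepsilon,s,\{F_n\})$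 and $\mathcal{M}(Z,s,\{F_n\})=\lim_{\varepsilon\to 0}\mathcal{M}(Z,\varepsilon,s,\{F_n\})$. The Bowen topological entropy $h^B_{top}(Z,\{F_n\})\in[0,+\infty]$ is the critical value of $s$ at which $\mathcal{M}(Z,s,\{F_n\})$ jumps from $+\infty$ to $0$, i.e. $\mathcal{M}(Z,s,\{F_n\})=0$ for $s>h^B_{top}(Z,\{F_n\})$ and $=+\infty$ for $s<h^B_{top}(Z,\{F_n\})$. Measure-theoretic entropy: for a finite measurable partition $\mathcal{P}$ of $X$ and finite $F\subset G$, let $\mathcal{P}^F=\bigvee_{g\in F}g^{-1}\mathcal{P}$, and $h_\mu(G,\mathcal{P})=\lim_{n\to+\infty}\frac{1}{|F_n|}H_\mu(\mathcal{P}^{F_n})$, where $H_\mu$ is Shannon entropy (the limit exists and does not depend on the Følner sequence). Then $h_\mu(X,G)=\sup_{\mathcal{P}}h_\mu(G,\mathcal{P})\in[0,+\infty]$, the supremum being over all finite measurable partitions. *)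

theory Defs
  imports
    "HOL-Algebra.Group_Action"
    "HOL-Library.Disjoint_Sets"
    "HOL-Probability.Probability_Measure"
begin

section \<open>Folner sequences\<close>

definition folner_seq :: "('g, 'm) monoid_scheme \<Rightarrow> (nat \<Rightarrow> 'g set) \<Rightarrow> bool" where
  "folner_seq G F \<longleftrightarrow>
     (\<forall>n. finite (F n) \<and> F n \<noteq> {} \<and> F n \<subseteq> carrier G) \<and>
     (\<forall>g\<in>carrier G.
        (\<lambda>n. real (card (sym_diff (F n) (g <#\<^bsub>G\<^esub> F n))) / real (card (F n)))
          \<longlonglongrightarrow> 0)"

definition amenable :: "('g, 'm) monoid_scheme \<Rightarrow> bool" where
  "amenable G \<longleftrightarrow> (\<exists>F. folner_seq G F)"

definition tempered :: "('g, 'm) monoid_scheme \<Rightarrow> (nat \<Rightarrow> 'g set) \<Rightarrow> bool" where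
  "tempered G F \<longleftrightarrow>
     (\<exists>C::real. \<forall>n. real (card (\<Union>k<n. (set_inv\<^bsub>G\<^esub> (F k)) <#>\<^bsub>G\<^esub> F n))
                     \<le> C * real (card (F n)))"


section \<open>Bowen topological entropy\<close>

definition bowen_ball ::
  "('g \<Rightarrow> 'x \<Rightarrow> 'x::metric_space) \<Rightarrow> 'g set \<Rightarrow> 'x \<Rightarrow> real \<Rightarrow> 'x set" where
  "bowen_ball \<phi> E x \<epsilon> = {y. \<forall>g\<in>E. dist (\<phi> g x) (\<phi> g y) < \<epsilon>}"

text \<open>
  Finite or countable families of Bowen balls are indexed by arbitrary subsets \<open>I\<close> of the
  naturals; the sum is taken in the extended nonnegative reals, so it always exists.
\<close>

definition bowen_M_N ::
  "('g \<Rightarrow> 'x \<Rightarrow> 'x::metric_space) \<Rightarrow> (nat \<Rightarrow> 'g set) \<Rightarrow> 'x set \<Rightarrow> nat \<Rightarrow> real \<Rightarrow> real \<Rightarrow> ennreal" where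
  "bowen_M_N \<phi> F Z N \<epsilon> s =
     Inf {(\<Sum>\<^sub>\<infinity>i\<in>I. ennreal (exp (- s * real (card (F (n i)))))) | (I::nat set) n x.
            (\<forall>i\<in>I. n i \<ge> N) \<and> Z \<subseteq> (\<Union>i\<in>I. bowen_ball \<phi> (F (n i)) (x i) \<epsilon>)}"

definition bowen_M_eps ::
  "('g \<Rightarrow> 'x \<Rightarrow> 'x::metric_space) \<Rightarrow> (nat \<Rightarrow> 'g set) \<Rightarrow> 'x set \<Rightarrow> real \<Rightarrow> real \<Rightarrow> ennreal" where
  "bowen_M_eps \<phi> F Z \<epsilon> s = lim (\<lambda>N. bowen_M_N \<phi> F Z N \<epsilon> s)"

definition bowen_M ::
  "('g \<Rightarrow> 'x \<Rightarrow> 'x::metric_space) \<Rightarrow> (nat \<Rightarrow> 'g set) \<Rightarrow> 'x set \<Rightarrow> real \<Rightarrow> ennreal" where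
  "bowen_M \<phi> F Z s = Lim (at_right 0) (\<lambda>\<epsilon>. bowen_M_eps \<phi> F Z \<epsilon> s)"

definition is_critical_value :: "(real \<Rightarrow> ennreal) \<Rightarrow> ennreal \<Rightarrow> bool" where
  "is_critical_value m h \<longleftrightarrow>
     (\<forall>s\<ge>0. (ennreal s > h \<longrightarrow> m s = 0) \<and> (ennreal s < h \<longrightarrow> m s = \<infinity>))"

definition bowen_entropy ::
  "('g \<Rightarrow> 'x \<Rightarrow> 'x::metric_space) \<Rightarrow> (nat \<Rightarrow> 'g set) \<Rightarrow> 'x set \<Rightarrow> ennreal" where
  "bowen_entropy \<phi> F Z = (THE h. is_critical_value (bowen_M \<phi> F Z) h)"

text \<open>
  The two limits exist by monotonicity, and the critical value exists and is unique as soon as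
  the cardinality of \<open>F n\<close> tends to infinity.
\<close>

lemma bowen_M_N_mono:
  assumes "N \<le> N'" "\<epsilon>' \<le> \<epsilon>"
  shows "bowen_M_N \<phi> F Z N \<epsilon> s \<le> bowen_M_N \<phi> F Z N' \<epsilon>' s"
proof -
  have ball: "bowen_ball \<phi> E x \<epsilon>' \<subseteq> bowen_ball \<phi> E x \<epsilon>" for E and x
    unfolding bowen_ball_def using assms(2) less_le_trans by blast
  have sub: "Z \<subseteq> (\<Union>i\<in>I. bowen_ball \<phi> (F (n i)) (x i) \<epsilon>)"
    if "Z \<subseteq> (\<Union>i\<in>I. bowen_ball \<phi> (F (n i)) (x i) \<epsilon>')" for I :: "nat set" and n x
    by (rule order_trans[OF that UN_mono[OF order_refl ball]])
  show ?thesis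
    unfolding bowen_M_N_def
  proof (rule Inf_superset_mono, safe)
    fix I :: "nat set" and n x
    assume n: "\<forall>i\<in>I. N' \<le> n i"
      and Z: "Z \<subseteq> (\<Union>i\<in>I. bowen_ball \<phi> (F (n i)) (x i) \<epsilon>')"
    have "\<forall>i\<in>I. N \<le> n i"
      using n assms(1) order_trans by blast
    with sub[OF Z] show "\<exists>(I'::nat set) n' x'.
        (\<Sum>\<^sub>\<infinity>i\<in>I. ennreal (exp (- s * real (card (F (n i)))))) =
        (\<Sum>\<^sub>\<infinity>i\<in>I'. ennreal (exp (- s * real (card (F (n' i)))))) \<and>
        (\<forall>i\<in>I'. N \<le> n' i) \<and> Z \<subseteq> (\<Union>i\<in>I'. bowen_ball \<phi> (F (n' i)) (x' i) \<epsilon>)"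
      by - (intro exI[of _ I] exI[of _ n] exI[of _ x], simp)
  qed
qed

lemma bowen_M_eps_LIMSEQ:
  "(\<lambda>N. bowen_M_N \<phi> F Z N \<epsilon> s) \<longlonglongrightarrow> bowen_M_eps \<phi> F Z \<epsilon> s"
proof -
  have "(\<lambda>N. bowen_M_N \<phi> F Z N \<epsilon> s) \<longlonglongrightarrow> (SUP N. bowen_M_N \<phi> F Z N \<epsilon> s)"
    by (intro LIMSEQ_SUP incseq_def[THEN iffD2] allI impI bowen_M_N_mono) auto
  then show ?thesis
    unfolding bowen_M_eps_def by (simp add: limI)
qed

lemma bowen_M_eps_antimono:
  assumes "\<epsilon>' \<le> \<epsilon>"
  shows "bowen_M_eps \<phi> F Z \<epsilon> s \<le> bowen_M_eps \<phi> F Z \<epsilon>' s"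
  by (rule LIMSEQ_le[OF bowen_M_eps_LIMSEQ bowen_M_eps_LIMSEQ])
     (use assms in \<open>auto intro: bowen_M_N_mono\<close>)

lemma bowen_M_eq_SUP: "bowen_M \<phi> F Z s = (SUP \<epsilon>\<in>{0<..}. bowen_M_eps \<phi> F Z \<epsilon> s)"
  and bowen_M_tendsto: "((\<lambda>\<epsilon>. bowen_M_eps \<phi> F Z \<epsilon> s) \<longlongrightarrow> bowen_M \<phi> F Z s) (at_right 0)"
proof -
  let ?S = "SUP \<epsilon>\<in>{0<..}. bowen_M_eps \<phi> F Z \<epsilon> s"
  have lim: "((\<lambda>\<epsilon>. bowen_M_eps \<phi> F Z \<epsilon> s) \<longlongrightarrow> ?S) (at_right 0)"
  proof (rule order_tendstoI)
    fix a assume "a < ?S"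
    then obtain e where e: "e > 0" "a < bowen_M_eps \<phi> F Z e s"
      by (auto simp: less_SUP_iff)
    have "\<forall>\<^sub>F \<epsilon> in at_right 0. \<epsilon> < e"
      using e(1) by (auto simp: eventually_at_right_field)
    then show "\<forall>\<^sub>F \<epsilon> in at_right 0. a < bowen_M_eps \<phi> F Z \<epsilon> s"
      by eventually_elim (use e(2) bowen_M_eps_antimono in \<open>blast intro: less_le_trans less_imp_le\<close>)
  next
    fix a assume a: "?S < a"
    have "bowen_M_eps \<phi> F Z \<epsilon> s < a" if "\<epsilon> > 0" for \<epsilon>
      by (rule le_less_trans[OF SUP_upper a]) (use that in auto)
    then show "\<forall>\<^sub>F \<epsilon> in at_right 0. bowen_M_eps \<phi> F Z \<epsilon> s < a"
      by (auto simp: eventually_at_right_field intro: exI[of _ 1])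
  qed
  then show "bowen_M \<phi> F Z s = ?S"
    unfolding bowen_M_def by (intro tendsto_Lim) auto
  with lim show "((\<lambda>\<epsilon>. bowen_M_eps \<phi> F Z \<epsilon> s) \<longlongrightarrow> bowen_M \<phi> F Z s) (at_right 0)"
    by simp
qed

lemma bowen_M_N_scale:
  assumes "0 \<le> s" "s \<le> t" and card: "\<And>k. k \<ge> N \<Longrightarrow> c \<le> real (card (F k))"
    and B: "bowen_M_N \<phi> F Z N \<epsilon> s < B"
  shows "bowen_M_N \<phi> F Z N \<epsilon> t \<le> ennreal (exp (- (t - s) * c)) * B"
proof -
  let ?k = "ennreal (exp (- (t - s) * c))"
  obtain I :: "nat set" and n x where n: "\<forall>i\<in>I. n i \<ge> N"
    and Z: "Z \<subseteq> (\<Union>i\<in>I. bowen_ball \<phi> (F (n i)) (x i) \<epsilon>)"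
    and less: "(\<Sum>\<^sub>\<infinity>i\<in>I. ennreal (exp (- s * real (card (F (n i)))))) < B"
    using B unfolding bowen_M_N_def Inf_less_iff by blast
  have "bowen_M_N \<phi> F Z N \<epsilon> t \<le> (\<Sum>\<^sub>\<infinity>i\<in>I. ennreal (exp (- t * real (card (F (n i))))))"
    unfolding bowen_M_N_def by (rule Inf_lower) (use n Z in blast)
  also have "\<dots> \<le> ?k * (\<Sum>\<^sub>\<infinity>i\<in>I. ennreal (exp (- s * real (card (F (n i))))))"
  proof (subst nonneg_infsum_complete, simp, rule SUP_least, safe)
    fix J assume J: "finite J" "J \<subseteq> I"
    have "(\<Sum>i\<in>J. ennreal (exp (- t * real (card (F (n i))))))
        \<le> (\<Sum>i\<in>J. ?k * ennreal (exp (- s * real (card (F (n i))))))"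
    proof (rule sum_mono)
      fix i assume "i \<in> J"
      then have "(t - s) * c \<le> (t - s) * real (card (F (n i)))"
        using n J card assms(2) by (intro mult_left_mono) auto
      then have "- t * real (card (F (n i))) \<le> - (t - s) * c + - s * real (card (F (n i)))"
        by (simp add: algebra_simps)
      then have "exp (- t * real (card (F (n i))))
          \<le> exp (- (t - s) * c) * exp (- s * real (card (F (n i))))"
        unfolding exp_add[symmetric] by (simp only: exp_le_cancel_iff)
      then show "ennreal (exp (- t * real (card (F (n i)))))
          \<le> ?k * ennreal (exp (- s * real (card (F (n i)))))"
        by (subst ennreal_mult[symmetric]) (auto intro: ennreal_leI)
    qed
    also have "\<dots> = ?k * (\<Sum>i\<in>J. ennreal (exp (- s * real (card (F (n i))))))"
      by (rule sum_distrib_left[symmetric])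
    also have "\<dots> \<le> ?k * (\<Sum>\<^sub>\<infinity>i\<in>I. ennreal (exp (- s * real (card (F (n i))))))"
      by (rule mult_left_mono, subst nonneg_infsum_complete) (use J in \<open>auto intro: SUP_upper\<close>)
    finally show "(\<Sum>i\<in>J. ennreal (exp (- t * real (card (F (n i))))))
        \<le> ?k * (\<Sum>\<^sub>\<infinity>i\<in>I. ennreal (exp (- s * real (card (F (n i))))))" .
  qed
  also have "\<dots> \<le> ?k * B"
    using less by (intro mult_left_mono) auto
  finally show ?thesis .
qed

lemma bowen_M_jump:
  assumes card: "filterlim (\<lambda>n. card (F n)) at_top sequentially"
    and "0 \<le> s" "s < t" and fin: "bowen_M \<phi> F Z s < \<infinity>"
  shows "bowen_M \<phi> F Z t = 0"
proof -
  have "bowen_M_eps \<phi> F Z \<epsilon> t = 0" if "\<epsilon> > 0" for \<epsilon>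
  proof -
    have "bowen_M_eps \<phi> F Z \<epsilon> s \<le> bowen_M \<phi> F Z s"
      unfolding bowen_M_eq_SUP by (rule SUP_upper) (use that in simp)
    then have "bowen_M_eps \<phi> F Z \<epsilon> s < \<infinity>"
      using fin by (simp add: le_less_trans)
    then obtain r where r: "bowen_M_eps \<phi> F Z \<epsilon> s = ennreal r" "0 \<le> r"
      by (cases "bowen_M_eps \<phi> F Z \<epsilon> s") auto
    define b where "b = r + 1"
    have b: "bowen_M_eps \<phi> F Z \<epsilon> s < ennreal b" "0 \<le> b"
      using r by (simp_all add: b_def ennreal_less_iff)
    have le: "bowen_M_N \<phi> F Z N \<epsilon> u \<le> bowen_M_eps \<phi> F Z \<epsilon> u" for N u
      by (rule incseq_le[OF _ bowen_M_eps_LIMSEQ]) (auto intro!: incseq_SucI bowen_M_N_mono)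
    have bound: "bowen_M_eps \<phi> F Z \<epsilon> t \<le> ennreal (exp (- (t - s) * real c) * b)" for c
    proof -
      obtain N where N: "\<And>k. k \<ge> N \<Longrightarrow> c \<le> card (F k)"
        using card unfolding filterlim_at_top eventually_sequentially by blast
      have "bowen_M_N \<phi> F Z k \<epsilon> t \<le> ennreal (exp (- (t - s) * real c)) * ennreal b" if "k \<ge> N" for k
        by (rule bowen_M_N_scale)
           (use N that assms(2,3) le_less_trans[OF le b(1)] in auto)
      then have "bowen_M_eps \<phi> F Z \<epsilon> t \<le> ennreal (exp (- (t - s) * real c)) * ennreal b"
        by (intro LIMSEQ_le_const2[OF bowen_M_eps_LIMSEQ]) blast
      then show ?thesis
        using b(2) by (simp add: ennreal_mult)
    qed
    have "filterlim (\<lambda>c. - (t - s) * real c) at_bot sequentially"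
      using assms(3)
      by (auto intro!: filterlim_tendsto_neg_mult_at_bot[OF tendsto_const] filterlim_real_sequentially)
    then have "(\<lambda>c. exp (- (t - s) * real c) * b) \<longlonglongrightarrow> 0 * b"
      by (intro tendsto_mult tendsto_const filterlim_compose[OF exp_at_bot])
    then have "(\<lambda>c. ennreal (exp (- (t - s) * real c) * b)) \<longlonglongrightarrow> ennreal 0"
      by (intro tendsto_ennrealI) simp
    then have "bowen_M_eps \<phi> F Z \<epsilon> t \<le> ennreal 0"
      by (rule LIMSEQ_le_const) (use bound in blast)
    then show ?thesis by simp
  qed
  then show ?thesis
    by (simp add: bowen_M_eq_SUP)
qed

lemma ex1_critical_value:
  assumes card: "filterlim (\<lambda>n. card (F n)) at_top sequentially"
  shows "\<exists>!h. is_critical_value (bowen_M \<phi> F Z) h"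
proof (rule ex_ex1I)
  let ?m = "bowen_M \<phi> F Z"
  let ?h = "Inf {ennreal s | s. 0 \<le> s \<and> ?m s = 0}"
  have "?m s = 0" if s: "0 \<le> s" "?h < ennreal s" for s
  proof -
    obtain r where r: "0 \<le> r" "?m r = 0" "ennreal r < ennreal s"
      using s(2) unfolding Inf_less_iff by blast
    have "r < s"
      using r(1,3) by (simp add: ennreal_less_iff)
    then show ?thesis
      using bowen_M_jump[OF card r(1), of s \<phi> Z] r(2) by (simp add: top.not_eq_extremum[symmetric])
  qed
  moreover have "?m s = \<infinity>" if s: "0 \<le> s" "ennreal s < ?h" for s
  proof (rule ccontr)
    assume "?m s \<noteq> \<infinity>"
    then have fin: "?m s < \<infinity>"
      by (simp add: less_top)
    obtain q where q: "ennreal s < q" "q < ?h"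
      using dense[OF s(2)] by blast
    then obtain r where "q = ennreal r" "0 \<le> r"
      by (cases q) auto
    with q have r: "0 \<le> r" "ennreal s < ennreal r" "ennreal r < ?h"
      by blast+
    have "s < r"
      using s(1) r(2) by (simp add: ennreal_less_iff)
    then have "?m r = 0"
      by (rule bowen_M_jump[OF card s(1) _ fin])
    then have "?h \<le> ennreal r"
      using r(1) by (intro Inf_lower) blast
    then show False
      using r(3) by simp
  qed
  ultimately show "\<exists>h. is_critical_value ?m h"
    unfolding is_critical_value_def by blast
next
  have False if h: "is_critical_value (bowen_M \<phi> F Z) h" "is_critical_value (bowen_M \<phi> F Z) h'"
    and less: "h < h'" for h h'
  proof -
    obtain q where q: "h < q" "q < h'"
      using dense[OF less] by blast
    then obtain s where "q = ennreal s" "0 \<le> s"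
      by (cases q) auto
    then show False
      using h q unfolding is_critical_value_def by fastforce
  qed
  then show "h = h'" if "is_critical_value (bowen_M \<phi> F Z) h" "is_critical_value (bowen_M \<phi> F Z) h'"
    for h h'
    using that by (meson linorder_neqE)
qed


section \<open>Measure-theoretic entropy\<close>

definition shannon_entropy :: "'x measure \<Rightarrow> 'x set set \<Rightarrow> real" where
  "shannon_entropy \<mu> P = - (\<Sum>A\<in>P. measure \<mu> A * ln (measure \<mu> A))"

text \<open>
  The join of the partitions \<open>g\<^sup>-\<^sup>1P\<close> for \<open>g \<in> E\<close>. The library's common refinement takes a set of
  partitions; repeated partitions do not affect a join, and empty cells are discarded.
\<close>

definition refined_partition :: "('g \<Rightarrow> 'x \<Rightarrow> 'x) \<Rightarrow> 'g set \<Rightarrow> 'x set set \<Rightarrow> 'x set set" where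
  "refined_partition \<phi> E P = common_refinement ((\<lambda>g. (\<lambda>A. \<phi> g -` A) ` P) ` E)"

definition partition_entropy ::
  "'x measure \<Rightarrow> ('g \<Rightarrow> 'x \<Rightarrow> 'x) \<Rightarrow> (nat \<Rightarrow> 'g set) \<Rightarrow> 'x set set \<Rightarrow> real" where
  "partition_entropy \<mu> \<phi> F P =
     lim (\<lambda>n. shannon_entropy \<mu> (refined_partition \<phi> (F n) P) / real (card (F n)))"

definition finite_measurable_partition :: "'x measure \<Rightarrow> 'x set set \<Rightarrow> bool" where
  "finite_measurable_partition \<mu> P \<longleftrightarrow>
     finite P \<and> P \<subseteq> sets \<mu> \<and> partition_on (space \<mu>) P"

text \<open>
  For an invariant measure of an action of an amenable group the limit in the entropy of a
  partition exists, is nonnegative and does not depend on the Folner sequence \<open>F\<close>.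
\<close>

definition measure_entropy ::
  "'x measure \<Rightarrow> ('g \<Rightarrow> 'x \<Rightarrow> 'x) \<Rightarrow> (nat \<Rightarrow> 'g set) \<Rightarrow> ennreal" where
  "measure_entropy \<mu> \<phi> F =
     (SUP P\<in>{P. finite_measurable_partition \<mu> P}. ennreal (partition_entropy \<mu> \<phi> F P))"

end

theory Submission
  imports Defs
begin

text \<open>
  The inequality is proved directly, without the Shannon-McMillan-Breiman theorem, so neither
  ergodicity nor a pointwise ergodic theorem is needed.

  If \<open>s\<close> exceeds the Bowen entropy of \<open>Y\<close>, then for every \<open>N\<close> almost all of the space is covered by
  finitely many Bowen balls of levels at least \<open>N\<close> with \<open>\<Sum> exp (- s * card (F n))\<close> as small as we like.
  In a large Folner window \<open>W\<close>, whenever a point \<open>\<phi> a x\<close> of the orbit lies in such a ball of level \<open>n\<close>,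
  the ball determines the orbit up to \<open>\<epsilon>\<close> along the tile \<open>F n #> a\<close>. A Vitali argument based on
  temperedness, repeated on finitely many scales, selects almost disjoint tiles that cover nearly all
  of \<open>W\<close>. Encoding the orbit by the selected balls costs \<open>s\<close> per site. The positions of the balls are
  free, because summing the weights over all families of balls gives a product close to \<open>1\<close> per site.
  By the Gibbs inequality the entropy of the partition over \<open>W\<close> is thus nearly at most
  \<open>s * card W\<close>.

  The cells of the partition are shrunk to compact sets, at positive distance from each other. The
  coarse partition recording only whether a point lies outside these compact sets, and in which
  cell, has small entropy and resolves the ambiguity of the Bowen balls. Shearer's inequality shows
  that the limit defining the entropy of a partition exists and is a lower bound for every window.
\<close>

section \<open>Vitali covering by tempered tiles\<close>

text \<open>The obstacle is that selecting almost disjoint tiles of many different sizes is only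
  guaranteed to cover \<open>c = 1 / (C / (1 - d) + 1 / d)\<close> times as many sites as there are
  admissible centres, so one cover leaves too much of the window unexplained. With \<open>r\<close>
  covers of rapidly growing levels the uncovered share falls to about \<open>(1 - c) ^ r\<close>,
  provided that the tiles of a later cover look invariant at the size of the earlier ones. This is
  why each countable cover is cut to finitely many balls: the union \<open>E t\<close> of the tile
  shapes is then finite, and all sufficiently late \<open>F n\<close> are almost invariant under it.
  The choices follow the order \<open>d\<close>, \<open>r\<close>, \<open>\<delta>\<close>, covers,
  levels, window, since each error is multiplied by quantities fixed before it. The tiles are
  selected separately for every point, with no measurability; this is harmless, because the code
  sums over all families of tiles and its length is bounded by a measurable function that does not
  depend on the selection.\<close>

context group
begin

lemma card_r_coset:
  assumes "E \<subseteq> carrier G" "a \<in> carrier G"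
  shows "card (E #> a) = card E"
proof -
  have "E #> a = (\<lambda>h. h \<otimes> a) ` E"
    unfolding r_coset_def by auto
  moreover have "inj_on (\<lambda>h. h \<otimes> a) E"
    using assms by (intro inj_onI) (meson subsetD right_cancel)
  ultimately show ?thesis
    by (simp add: card_image)
qed

lemma finite_r_coset: "finite E \<Longrightarrow> finite (E #> a)"
  unfolding r_coset_def by auto

text \<open>The greedy selection is replaced by a largest family satisfying the first bound.\<close>

lemma single_level_cover:
  fixes d :: real
  assumes A: "finite A" "A \<subseteq> carrier G" and E: "finite E" "E \<noteq> {}" "E \<subseteq> carrier G"
    and d: "0 < d" "d < 1"
  obtains S where "S \<subseteq> A"
    "(1 - d) * real (card S) * real (card E) \<le> real (card (\<Union>a\<in>S. E #> a))"
    "d * real (card A) \<le> real (card (\<Union>a\<in>S. E #> a))"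
proof -
  define U where "U S = (\<Union>a\<in>S. E #> a)" for S
  define good where "good S \<longleftrightarrow> S \<subseteq> A \<and> (1 - d) * real (card S) * real (card E) \<le> real (card (U S))" for S
  have "good {}"
    by (simp add: good_def U_def)
  moreover have "\<And>S. good S \<Longrightarrow> card S \<le> card A"
    using A card_mono by (auto simp: good_def)
  ultimately have "\<exists>S. good S \<and> (\<forall>S'. good S' \<longrightarrow> card S' \<le> card S)"
    by (intro ex_has_greatest_nat[of good "{}" card "Suc (card A)"]) (auto simp: less_Suc_eq_le)
  then obtain S where S: "good S" and max: "\<And>S'. good S' \<Longrightarrow> card S' \<le> card S"
    by blast
  have SA: "S \<subseteq> A" and finS: "finite S"
    using S A finite_subset by (auto simp: good_def)
  have finU: "finite (U S)"
    unfolding U_def using finS E finite_r_coset by simp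
  have Epos: "0 < card E"
    using E by (simp add: card_gt_0_iff)
  \<comment> \<open>Otherwise the tile at \<open>a\<close> would add more than
    \<open>(1 - d) * card E\<close> new sites, making \<open>insert a S\<close> good and larger than
    \<open>S\<close>.\<close>
  have hit: "d * real (card E) \<le> real (card ((E #> a) \<inter> U S))" if a: "a \<in> A" for a
  proof (cases "a \<in> S")
    case True
    then have "(E #> a) \<inter> U S = E #> a"
      unfolding U_def by blast
    moreover have "card (E #> a) = card E"
      by (rule card_r_coset) (use E A a in auto)
    ultimately show ?thesis
      using d by (simp add: mult_left_le_one_le)
  next
    case False
    have cardE: "card (E #> a) = card E"
      by (rule card_r_coset) (use E A a in auto)
    have fin: "finite (E #> a)"
      using E finite_r_coset by simp
    have "\<not> good (insert a S)"
      using max[of "insert a S"] False finS by auto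
    then have "real (card (U (insert a S))) < (1 - d) * (real (card S) + 1) * real (card E)"
      using SA a False finS by (auto simp: good_def not_le add.commute)
    moreover have "U (insert a S) = U S \<union> ((E #> a) - U S)"
      by (auto simp: U_def)
    moreover have "card (U S \<union> ((E #> a) - U S)) = card (U S) + card ((E #> a) - U S)"
      by (rule card_Un_disjoint) (use finU fin in auto)
    ultimately have "real (card ((E #> a) - U S)) < (1 - d) * real (card E)"
      using S by (auto simp: good_def algebra_simps)
    moreover have "card ((E #> a) - U S) + card ((E #> a) \<inter> U S) = card E"
      using fin cardE card_Diff_subset_Int[of "E #> a" "U S"] card_mono[of "E #> a" "(E #> a) \<inter> U S"] by auto
    then have "real (card ((E #> a) - U S)) + real (card ((E #> a) \<inter> U S)) = real (card E)"
      by (metis of_nat_add)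
    ultimately show ?thesis
      by (simp add: left_diff_distrib)
  qed
  \<comment> \<open>Double counting of the pairs \<open>(a, u)\<close> with \<open>u\<close> in the
    tile at \<open>a\<close>: a site \<open>u\<close> can only be hit from the centres
    \<open>inv h \<otimes> u\<close> with \<open>h \<in> E\<close>.\<close>
  have "d * real (card E) * real (card A) \<le> (\<Sum>a\<in>A. real (card ((E #> a) \<inter> U S)))"
    using sum_mono[OF hit, of A "\<lambda>x. x"] by (simp add: mult.commute)
  also have "\<dots> = real (\<Sum>a\<in>A. card ((E #> a) \<inter> U S))"
    by simp
  also have "(\<Sum>a\<in>A. card ((E #> a) \<inter> U S)) = (\<Sum>a\<in>A. \<Sum>u\<in>U S. if u \<in> E #> a then 1 else 0)"
  proof (rule sum.cong[OF refl])
    fix a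
    have "(E #> a) \<inter> U S = {u\<in>U S. u \<in> E #> a}" by auto
    then show "card ((E #> a) \<inter> U S) = (\<Sum>u\<in>U S. if u \<in> E #> a then 1 else 0)"
      using finU by (simp add: sum.If_cases Int_def)
  qed
  also have "\<dots> = (\<Sum>u\<in>U S. \<Sum>a\<in>A. if u \<in> E #> a then 1 else 0)"
    by (rule sum.swap)
  also have "\<dots> \<le> (\<Sum>u\<in>U S. card E)"
  proof (rule sum_mono)
    fix u
    have "(\<Sum>a\<in>A. if u \<in> E #> a then 1 else 0) = card {a\<in>A. u \<in> E #> a}"
      using A by (simp add: sum.If_cases Int_def)
    also have "{a\<in>A. u \<in> E #> a} \<subseteq> (\<lambda>h. inv h \<otimes> u) ` E"
    proof
      fix a assume "a \<in> {a\<in>A. u \<in> E #> a}"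
      then obtain h where "h \<in> E" "u = h \<otimes> a" "a \<in> A"
        by (auto simp: r_coset_def)
      then have "a = inv h \<otimes> u"
        using A E by (simp add: inv_solve_left subset_iff)
      then show "a \<in> (\<lambda>h. inv h \<otimes> u) ` E"
        using \<open>h \<in> E\<close> by blast
    qed
    then have "card {a\<in>A. u \<in> E #> a} \<le> card E"
      using E by (meson card_image_le card_mono finite_imageI le_trans)
    finally show "(\<Sum>a\<in>A. if u \<in> E #> a then 1 else 0) \<le> card E" .
  qed
  also have "\<dots> = card (U S) * card E"
    by simp
  finally have "d * real (card A) * real (card E) \<le> real (card (U S)) * real (card E)"
    by (simp add: ac_simps)
  then have "d * real (card A) \<le> real (card (U S))"
    using Epos by simp
  with S SA show thesis
    by (intro that[of S]) (auto simp: good_def U_def)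
qed

text \<open>Solving \<open>h \<otimes> a = u \<otimes> b\<close> for \<open>a\<close> turns the
  meeting of two tiles into a condition on their centres; this is where temperedness becomes
  applicable.\<close>

lemma in_set_inv_mult:
  assumes "h \<in> E" "u \<in> B" "h \<otimes> a = u \<otimes> b" "E \<subseteq> carrier G" "B \<subseteq> carrier G" "a \<in> carrier G" "b \<in> carrier G"
  shows "a \<in> (set_inv E <#> B) #> b"
proof -
  have "a = inv h \<otimes> (u \<otimes> b)"
    using assms by (metis inv_solve_left subsetD m_closed)
  also have "\<dots> = (inv h \<otimes> u) \<otimes> b"
    using assms by (simp add: m_assoc subset_iff)
  finally show ?thesis
    using assms(1,2) unfolding r_coset_def set_mult_def SET_INV_def by blast
qed

lemma set_inv_closed: "E \<subseteq> carrier G \<Longrightarrow> set_inv E \<subseteq> carrier G"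
  unfolding SET_INV_def by auto

lemma finite_set_inv: "finite E \<Longrightarrow> finite (set_inv E)"
  unfolding SET_INV_def by auto

lemma finite_set_mult: "finite A \<Longrightarrow> finite B \<Longrightarrow> finite (A <#> B)"
  unfolding set_mult_def by auto

end

locale tempered_sequence = group G for G (structure) +
  fixes F :: "nat \<Rightarrow> 'a set" and C :: real
  assumes finite_F: "finite (F n)" and nonempty_F: "F n \<noteq> {}" and F_carrier: "F n \<subseteq> carrier G"
    and C_nonneg: "0 \<le> C"
    and tempered_bound: "real (card (\<Union>k<n. set_inv (F k) <#> F n)) \<le> C * real (card (F n))"
begin

text \<open>
  Levels are processed downwards. A point of lower level whose tile meets a selected tile of
  level \<open>n\<close> lies in a translate of the set controlled by temperedness.
\<close>

lemma one_scale_cover: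
  fixes d :: real
  assumes d: "0 < d" "d < 1"
    and "finite A" "A \<subseteq> carrier G" "\<And>a. a \<in> A \<Longrightarrow> lev a < m"
  shows "\<exists>S\<subseteq>A. real (card A) \<le> (C / (1 - d) + 1 / d) * real (card (\<Union>a\<in>S. F (lev a) #> a)) \<and>
      (1 - d) * (\<Sum>a\<in>S. real (card (F (lev a)))) \<le> real (card (\<Union>a\<in>S. F (lev a) #> a))"
  using assms(3-)
proof (induction m arbitrary: A)
  case 0
  then have "A = {}" by blast
  then show ?case by simp
next
  case (Suc m)
  \<comment> \<open>\<open>1 / d\<close> pays for the centres of level \<open>m\<close> and
    \<open>C / (1 - d)\<close> for the blocked ones of lower level, both in terms of
    \<open>card U1\<close>. The rest \<open>A'\<close> is charged to \<open>U2\<close>, disjoint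
    from \<open>U1\<close>, so \<open>K\<close> does not grow in the induction.\<close>
  define K where "K = C / (1 - d) + 1 / d"
  define top where "top = {a\<in>A. lev a = m}"
  have top: "finite top" "top \<subseteq> carrier G"
    using Suc.prems by (auto simp: top_def)
  obtain S1 where S1: "S1 \<subseteq> top"
    "(1 - d) * real (card S1) * real (card (F m)) \<le> real (card (\<Union>a\<in>S1. F m #> a))"
    "d * real (card top) \<le> real (card (\<Union>a\<in>S1. F m #> a))"
    using single_level_cover[OF top finite_F nonempty_F F_carrier d] by metis
  define U1 where "U1 = (\<Union>a\<in>S1. F m #> a)"
  define A' where "A' = {a\<in>A. lev a < m \<and> (F (lev a) #> a) \<inter> U1 = {}}"
  have A': "finite A'" "A' \<subseteq> carrier G" "\<And>a. a \<in> A' \<Longrightarrow> lev a < m"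
    using Suc.prems by (auto simp: A'_def)
  obtain S2 where S2: "S2 \<subseteq> A'"
    "real (card A') \<le> K * real (card (\<Union>a\<in>S2. F (lev a) #> a))"
    "(1 - d) * (\<Sum>a\<in>S2. real (card (F (lev a)))) \<le> real (card (\<Union>a\<in>S2. F (lev a) #> a))"
    using Suc.IH[OF A'] unfolding K_def by blast
  define U2 where "U2 = (\<Union>a\<in>S2. F (lev a) #> a)"
  define blocked where "blocked = (\<Union>b\<in>S1. (\<Union>k<m. set_inv (F k) <#> F m) #> b)"
  have fin: "finite S1" "finite S2"
    using S1(1) S2(1) top(1) A'(1) finite_subset by blast+
  have finU: "finite U1" "finite U2"
    unfolding U1_def U2_def using fin finite_F finite_r_coset by simp_all
  have lev1: "lev a = m" if "a \<in> S1" for a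
    using that S1(1) by (auto simp: top_def)
  have U1_eq: "U1 = (\<Union>a\<in>S1. F (lev a) #> a)"
    unfolding U1_def using lev1 by simp
  have S1_carrier: "S1 \<subseteq> carrier G"
    using S1(1) top by blast
  have finite_T: "finite (\<Union>k<m. set_inv (F k) <#> F m)"
    using finite_F finite_set_inv finite_set_mult by simp
  have T_carrier: "(\<Union>k<m. set_inv (F k) <#> F m) \<subseteq> carrier G"
    using F_carrier set_inv_closed set_mult_closed by (simp add: UN_subset_iff)
  have "A \<subseteq> top \<union> blocked \<union> A'"
  proof
    fix a assume a: "a \<in> A"
    show "a \<in> top \<union> blocked \<union> A'"
    proof (cases "lev a = m \<or> a \<in> A'")
      case True
      then show ?thesis using a by (auto simp: top_def)
    next
      case False
      then have lt: "lev a < m"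
        using Suc.prems(3)[OF a] by auto
      with False a have "(F (lev a) #> a) \<inter> U1 \<noteq> {}"
        by (auto simp: A'_def)
      then obtain b h u where b: "b \<in> S1" "h \<in> F (lev a)" "u \<in> F m" "h \<otimes> a = u \<otimes> b"
        unfolding U1_def r_coset_def by blast
      then have "a \<in> (set_inv (F (lev a)) <#> F m) #> b"
        using F_carrier a Suc.prems(2) S1_carrier by (intro in_set_inv_mult) auto
      then have "a \<in> blocked"
        unfolding blocked_def r_coset_def using b(1) lt by blast
      then show ?thesis by blast
    qed
  qed
  then have "card A \<le> card (top \<union> blocked \<union> A')"
    by (rule card_mono[rotated])
       (use top A' fin finite_T finite_r_coset in \<open>simp add: blocked_def\<close>)
  also have "\<dots> \<le> card top + card blocked + card A'"
    by (meson card_Un_le add_mono le_trans order_refl)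
  finally have card_A: "real (card A) \<le> real (card top) + real (card blocked) + real (card A')"
    by linarith
  have "card blocked \<le> (\<Sum>b\<in>S1. card (\<Union>k<m. set_inv (F k) <#> F m))"
    unfolding blocked_def
    by (rule order_trans[OF card_UN_le[OF fin(1)]], rule sum_mono)
       (use card_r_coset[OF T_carrier] S1_carrier in auto)
  then have "real (card blocked) \<le> real (card S1) * real (card (\<Union>k<m. set_inv (F k) <#> F m))"
    by (simp flip: of_nat_mult)
  also have "\<dots> \<le> real (card S1) * (C * real (card (F m)))"
    using tempered_bound by (intro mult_left_mono) auto
  also have "\<dots> = C * (real (card S1) * real (card (F m)))"
    by simp
  also have "\<dots> \<le> C * (real (card U1) / (1 - d))"
    using S1(2) d C_nonneg by (intro mult_left_mono) (auto simp: U1_def field_simps)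
  finally have card_blocked: "real (card blocked) \<le> C / (1 - d) * real (card U1)"
    by simp
  have card_top: "real (card top) \<le> 1 / d * real (card U1)"
    using S1(3) d by (simp add: U1_def field_simps)
  have disj: "U1 \<inter> U2 = {}"
    using S2(1) unfolding U2_def A'_def by blast
  have card_U: "real (card (U1 \<union> U2)) = real (card U1) + real (card U2)"
    using card_Un_disjoint[OF finU disj] by simp
  have "S1 \<inter> S2 = {}"
    using S1(1) S2(1) by (auto simp: top_def A'_def)
  then have "(\<Sum>a\<in>S1 \<union> S2. real (card (F (lev a))))
      = real (card S1) * real (card (F m)) + (\<Sum>a\<in>S2. real (card (F (lev a))))"
    using lev1 by (simp add: sum.union_disjoint[OF fin])
  then have "(1 - d) * (\<Sum>a\<in>S1 \<union> S2. real (card (F (lev a)))) \<le> real (card (U1 \<union> U2))"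
    using S1(2) S2(3) card_U by (simp add: U1_def U2_def distrib_left mult.assoc)
  moreover have "real (card A) \<le> K * real (card (U1 \<union> U2))"
    using card_A card_blocked card_top S2(2) card_U
    by (simp add: K_def U2_def[symmetric] distrib_left distrib_right)
  moreover have "(\<Union>a\<in>S1 \<union> S2. F (lev a) #> a) = U1 \<union> U2"
    unfolding U1_eq U2_def by blast
  moreover have "S1 \<union> S2 \<subseteq> A"
    using S1(1) S2(1) by (auto simp: top_def A'_def)
  ultimately show ?case
    unfolding K_def by (intro exI[of _ "S1 \<union> S2"]) simp
qed

text \<open>
  Scales are processed downwards. A point whose tile at scale \<open>t\<close> meets a selected tile of a
  higher scale without lying in it belongs to the thin boundary of that tile.
\<close>

lemma multi_scale_cover:
  fixes d b :: real and r :: nat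
  defines "c \<equiv> 1 / (C / (1 - d) + 1 / d)"
  assumes d: "0 < d" "d < 1" and b: "0 \<le> b"
    and W: "finite W" "W \<subseteq> carrier G"
    and E: "\<And>t. t < r \<Longrightarrow> finite (E t) \<and> E t \<subseteq> carrier G"
    and D: "\<And>t. t < r \<Longrightarrow> D t \<subseteq> W"
    and FE: "\<And>t a. t < r \<Longrightarrow> a \<in> D t \<Longrightarrow> F (lev t a) \<subseteq> E t"
    and FW: "\<And>t a. t < r \<Longrightarrow> a \<in> D t \<Longrightarrow> F (lev t a) #> a \<subseteq> W"
    and thin: "\<And>t t' a. t < t' \<Longrightarrow> t' < r \<Longrightarrow> a \<in> D t' \<Longrightarrow>
      real (card ((set_inv (E t) <#> F (lev t' a)) - F (lev t' a))) \<le> b * real (card (F (lev t' a)))"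
  shows "\<exists>S\<subseteq>Sigma {..<r} D.
      (1 - d) * (\<Sum>(t, a)\<in>S. real (card (F (lev t a)))) \<le> real (card (\<Union>(t, a)\<in>S. F (lev t a) #> a)) \<and>
      real (card W) - real (card (\<Union>(t, a)\<in>S. F (lev t a) #> a))
        \<le> (1 - c) ^ r * real (card W) + (\<Sum>t<r. real (card (W - D t))) + real r * (b * real (card W) / (1 - d))"
proof -
  define K where "K = C / (1 - d) + 1 / d"
  have "1 \<le> 1 / d" "0 \<le> C / (1 - d)"
    using d C_nonneg by auto
  then have K: "1 \<le> K" and c: "0 < c" "c \<le> 1" "c * K = 1"
    by (auto simp: K_def c_def field_simps)
  \<comment> \<open>A bound for all boundaries together: the selected tiles overlap so little that
    their sizes add up to at most \<open>card W / (1 - d)\<close>.\<close>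
  define \<beta> where "\<beta> = b * real (card W) / (1 - d)"
  have \<beta>: "0 \<le> \<beta>"
    using b d by (simp add: \<beta>_def)
  define U where "U S = (\<Union>(t, a)\<in>S. F (lev t a) #> a)" for S
  have finite_Sigma: "finite (Sigma I D)" if "I \<subseteq> {..<r}" for I
    using that W(1) D by (intro finite_SigmaI) (meson finite_lessThan finite_subset lessThan_iff subsetD)+
  have "\<exists>S\<subseteq>Sigma {r - k..<r} D.
      (1 - d) * (\<Sum>(t, a)\<in>S. real (card (F (lev t a)))) \<le> real (card (U S)) \<and>
      real (card W) - real (card (U S))
        \<le> (1 - c) ^ k * real (card W) + (\<Sum>t\<in>{r - k..<r}. real (card (W - D t))) + real k * \<beta>"
    if "k \<le> r" for k
    using that
  proof (induction k)
    case 0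
    show ?case
      by (rule exI[of _ "{}"]) (simp add: U_def)
  next
    case (Suc k)
    define m where "m = r - Suc k"
    have m: "m < r" "r - k = Suc m" "{m..<r} = insert m {Suc m..<r}"
      using Suc.prems by (auto simp: m_def)
    obtain S where S: "S \<subseteq> Sigma {Suc m..<r} D"
      "(1 - d) * (\<Sum>(t, a)\<in>S. real (card (F (lev t a)))) \<le> real (card (U S))"
      "real (card W) - real (card (U S))
        \<le> (1 - c) ^ k * real (card W) + (\<Sum>t\<in>{Suc m..<r}. real (card (W - D t))) + real k * \<beta>"
      using Suc.IH Suc.prems m(2) by auto
    have finS: "finite S"
      by (rule finite_subset[OF S(1)], rule finite_Sigma) auto
    have US: "U S \<subseteq> W"
      using S(1) FW by (fastforce simp: U_def)
    have finU: "finite (U S)"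
      using US W finite_subset by blast
    define A where "A = {a\<in>D m. (F (lev m a) #> a) \<inter> U S = {}}"
    have "A \<subseteq> W"
      using D[OF m(1)] by (auto simp: A_def)
    with W have A: "finite A" "A \<subseteq> carrier G"
      using finite_subset by auto
    define mx where "mx = Suc (Max (lev m ` A))"
    have "lev m a < mx" if "a \<in> A" for a
      using that A by (auto simp: mx_def less_Suc_eq_le)
    then obtain S' where S': "S' \<subseteq> A"
      "real (card A) \<le> K * real (card (\<Union>a\<in>S'. F (lev m a) #> a))"
      "(1 - d) * (\<Sum>a\<in>S'. real (card (F (lev m a)))) \<le> real (card (\<Union>a\<in>S'. F (lev m a) #> a))"
      using one_scale_cover[OF d A, of "lev m" mx] unfolding K_def by blast
    define U' where "U' = (\<Union>a\<in>S'. F (lev m a) #> a)"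
    have finS': "finite S'"
      using S'(1) A finite_subset by blast
    have finU': "finite U'"
      unfolding U'_def using finS' finite_F finite_r_coset by simp
    have disj: "U S \<inter> U' = {}"
      unfolding U'_def using S'(1) by (auto simp: A_def)
    define B where "B = (\<Union>(t, a)\<in>S. ((set_inv (E m) <#> F (lev t a)) - F (lev t a)) #> a)"
    have bdry: "real (card (((set_inv (E m) <#> F (lev t a)) - F (lev t a)) #> a)) \<le> b * real (card (F (lev t a)))"
      and finB: "finite (((set_inv (E m) <#> F (lev t a)) - F (lev t a)) #> a)"
      if "(t, a) \<in> S" for t a
    proof -
      have ta: "m < t" "t < r" "a \<in> D t" "a \<in> carrier G"
        using that S(1) D W by fastforce+
      have "set_inv (E m) <#> F (lev t a) \<subseteq> carrier G"
        using E[OF m(1)] F_carrier set_inv_closed by (intro set_mult_closed) auto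
      then have "(set_inv (E m) <#> F (lev t a)) - F (lev t a) \<subseteq> carrier G"
        by auto
      then show "real (card (((set_inv (E m) <#> F (lev t a)) - F (lev t a)) #> a)) \<le> b * real (card (F (lev t a)))"
        using card_r_coset ta thin[of m t a] by simp
      show "finite (((set_inv (E m) <#> F (lev t a)) - F (lev t a)) #> a)"
        using E[OF m(1)] finite_F finite_set_inv finite_set_mult finite_r_coset by simp
    qed
    have "W \<subseteq> (W - D m) \<union> A \<union> U S \<union> B"
    proof
      fix a assume a: "a \<in> W"
      show "a \<in> (W - D m) \<union> A \<union> U S \<union> B"
      proof (cases "a \<in> (W - D m) \<union> A \<union> U S")
        case False
        then have "a \<in> D m" "(F (lev m a) #> a) \<inter> U S \<noteq> {}" "a \<notin> U S"
          using a by (auto simp: A_def)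
        then obtain t b h u where tb: "(t, b) \<in> S" "h \<in> F (lev m a)" "u \<in> F (lev t b)" "h \<otimes> a = u \<otimes> b"
          unfolding U_def r_coset_def by blast
        have "b \<in> carrier G" "a \<in> carrier G" "h \<in> E m"
          using tb(1,2) S(1) D W a FE[OF m(1) \<open>a \<in> D m\<close>] by fastforce+
        then have "a \<in> (set_inv (E m) <#> F (lev t b)) #> b"
          using tb E[OF m(1)] F_carrier by (intro in_set_inv_mult[of h _ u]) auto
        moreover have "a \<notin> F (lev t b) #> b"
          using \<open>a \<notin> U S\<close> tb(1) by (auto simp: U_def)
        ultimately have "a \<in> ((set_inv (E m) <#> F (lev t b)) - F (lev t b)) #> b"
          by (auto simp: r_coset_def)
        then show ?thesis
          using tb(1) by (auto simp: B_def)
      qed blast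
    qed
    then have "card W \<le> card ((W - D m) \<union> A \<union> U S \<union> B)"
      by (rule card_mono[rotated])
         (use W A finU finS finB in \<open>auto simp: B_def\<close>)
    also have "\<dots> \<le> card (W - D m) + card A + card (U S) + card B"
      by (meson card_Un_le add_mono le_trans order_refl)
    finally have card_W: "real (card W) \<le> real (card (W - D m)) + real (card A) + real (card (U S)) + real (card B)"
      by linarith
    have "real (card B) \<le> real (\<Sum>p\<in>S. card (case p of (t, a) \<Rightarrow> ((set_inv (E m) <#> F (lev t a)) - F (lev t a)) #> a))"
      unfolding B_def of_nat_le_iff by (rule card_UN_le[OF finS])
    also have "\<dots> \<le> (\<Sum>(t, a)\<in>S. b * real (card (F (lev t a))))"
      unfolding of_nat_sum by (rule sum_mono) (use bdry in auto)
    also have "\<dots> = b * (\<Sum>(t, a)\<in>S. real (card (F (lev t a))))"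
      by (simp add: sum_distrib_left split_def)
    also have "\<dots> \<le> b * (real (card (U S)) / (1 - d))"
      using S(2) d b by (intro mult_left_mono) (auto simp: field_simps)
    also have "\<dots> \<le> b * (real (card W) / (1 - d))"
      using d b card_mono[OF W(1) US] by (intro mult_left_mono divide_right_mono) auto
    finally have card_B: "real (card B) \<le> \<beta>"
      by (simp add: \<beta>_def)
    let ?S = "S \<union> Pair m ` S'"
    have sum_eq: "(\<Sum>(t, a)\<in>?S. real (card (F (lev t a))))
        = (\<Sum>(t, a)\<in>S. real (card (F (lev t a)))) + (\<Sum>a\<in>S'. real (card (F (lev m a))))"
    proof -
      have "S \<inter> Pair m ` S' = {}"
        using S(1) by fastforce
      then have "(\<Sum>(t, a)\<in>?S. real (card (F (lev t a))))
        = (\<Sum>(t, a)\<in>S. real (card (F (lev t a)))) + (\<Sum>(t, a)\<in>Pair m ` S'. real (card (F (lev t a))))"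
        using finS finS' by (intro sum.union_disjoint) auto
      then show ?thesis
        by (simp add: sum.reindex inj_on_def)
    qed
    have U_eq: "U ?S = U S \<union> U'"
      unfolding U_def U'_def by auto
    then have card_U: "real (card (U ?S)) = real (card (U S)) + real (card U')"
      using card_Un_disjoint[OF finU finU' disj] by simp
    have "real (card W) - real (card (U ?S)) \<le> real (card W) - real (card (U S)) - c * real (card A)"
    proof -
      have "c * real (card A) \<le> c * (K * real (card U'))"
        using S'(2) c by (intro mult_left_mono) (auto simp: U'_def)
      also have "\<dots> = (c * K) * real (card U')"
        by simp
      finally show ?thesis
        using c(3) card_U by simp
    qed
    \<comment> \<open>Recursion for the remainder \<open>card W - card (U S)\<close>: by
      \<open>card_W\<close>, \<open>card A\<close> is at least this remainder minus the inadmissible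
      centres and the boundaries, and \<open>c * card A\<close> has just been subtracted.\<close>
    also have "\<dots> \<le> (1 - c) * (real (card W) - real (card (U S))) + c * (real (card (W - D m)) + \<beta>)"
    proof -
      have "c * (real (card W) - real (card (U S)) - (real (card (W - D m)) + \<beta>)) \<le> c * real (card A)"
        using card_W card_B c by (intro mult_left_mono) auto
      then show ?thesis
        by (simp add: algebra_simps)
    qed
    also have "\<dots> \<le> (1 - c) * (real (card W) - real (card (U S))) + (real (card (W - D m)) + \<beta>)"
      using c \<beta> by (intro add_left_mono mult_left_le_one_le) auto
    also have "\<dots> \<le> (1 - c) * ((1 - c) ^ k * real (card W)) +
        ((\<Sum>t\<in>{Suc m..<r}. real (card (W - D t))) + real k * \<beta>) + (real (card (W - D m)) + \<beta>)"
    proof -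
      have "0 \<le> (\<Sum>t\<in>{Suc m..<r}. real (card (W - D t))) + real k * \<beta>"
        using \<beta> by (intro add_nonneg_nonneg sum_nonneg) auto
      then have "(1 - c) * ((\<Sum>t\<in>{Suc m..<r}. real (card (W - D t))) + real k * \<beta>)
          \<le> (\<Sum>t\<in>{Suc m..<r}. real (card (W - D t))) + real k * \<beta>"
        using c by (intro mult_left_le_one_le) auto
      moreover have "(1 - c) * (real (card W) - real (card (U S))) \<le> (1 - c) * ((1 - c) ^ k * real (card W) +
          ((\<Sum>t\<in>{Suc m..<r}. real (card (W - D t))) + real k * \<beta>))"
        using S(3) c by (intro mult_left_mono) (auto simp: add.assoc)
      ultimately show ?thesis
        unfolding distrib_left by linarith
    qed
    also have "\<dots> = (1 - c) ^ Suc k * real (card W) + (\<Sum>t\<in>{m..<r}. real (card (W - D t))) + real (Suc k) * \<beta>"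
      using m(3) by (simp add: distrib_right)
    finally have rem: "real (card W) - real (card (U ?S)) \<le> \<dots>" .
    have "(1 - d) * (\<Sum>(t, a)\<in>?S. real (card (F (lev t a)))) \<le> real (card (U ?S))"
      using S(2) S'(3) sum_eq card_U by (simp add: U'_def distrib_left)
    moreover have "?S \<subseteq> Sigma {m..<r} D"
      using S(1) S'(1) m(1) by (fastforce simp: A_def)
    ultimately show ?case
      using rem unfolding m_def[symmetric] by blast
  qed
  from this[of r] show ?thesis
    by (simp add: U_def \<beta>_def atLeast0LessThan)
qed

end

section \<open>Almost invariance of Folner sets under finite sets of translations\<close>

context group
begin

text \<open>The factor \<open>card E\<close> on the left lets these bounds be summed over
  \<open>h \<in> E\<close> without spoiling \<open>\<delta>\<close>.\<close>

lemma folner_eventually: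
  assumes F: "folner_seq G F" and E: "finite E" "E \<subseteq> carrier G" and \<delta>: "0 < \<delta>"
  shows "\<forall>\<^sub>F n in sequentially. \<forall>h\<in>E.
    real (card E) * real (card ((h <# F n) - F n)) \<le> \<delta> * real (card (F n))"
proof (rule eventually_ball_finite[OF E(1)], rule ballI)
  fix h assume h: "h \<in> E"
  then have pos: "0 < real (card E)"
    using E by (auto simp: card_gt_0_iff)
  have "(\<lambda>n. real (card (sym_diff (F n) (h <# F n))) / real (card (F n))) \<longlonglongrightarrow> 0"
    using F h E by (auto simp: folner_seq_def)
  then have "\<forall>\<^sub>F n in sequentially.
      real (card (sym_diff (F n) (h <# F n))) / real (card (F n)) < \<delta> / real (card E)"
    by (rule order_tendstoD(2)) (use \<delta> pos in simp)
  then show "\<forall>\<^sub>F n in sequentially. real (card E) * real (card ((h <# F n) - F n)) \<le> \<delta> * real (card (F n))"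
  proof eventually_elim
    case (elim n)
    have Fn: "finite (F n)" "F n \<noteq> {}"
      using F by (auto simp: folner_seq_def)
    then have "0 < real (card (F n))"
      by (simp add: card_gt_0_iff)
    then have "real (card E) * real (card (sym_diff (F n) (h <# F n))) < \<delta> * real (card (F n))"
      using elim pos by (simp add: field_simps)
    moreover have "card ((h <# F n) - F n) \<le> card (sym_diff (F n) (h <# F n))"
      by (rule card_mono) (use Fn in \<open>auto simp: l_coset_def\<close>)
    then have "real (card E) * real (card ((h <# F n) - F n)) \<le> real (card E) * real (card (sym_diff (F n) (h <# F n)))"
      by (intro mult_left_mono) auto
    ultimately show ?case
      by linarith
  qed
qed

lemma sum_translates_bound:
  assumes "finite E" and "0 \<le> B" and le: "\<And>h. h \<in> E \<Longrightarrow> real (card E) * real (f h) \<le> B"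
  shows "real (\<Sum>h\<in>E. f h) \<le> B"
proof (cases "E = {}")
  case False
  have "real (card E) * real (\<Sum>h\<in>E. f h) = (\<Sum>h\<in>E. real (card E) * real (f h))"
    by (simp add: sum_distrib_left)
  also have "\<dots> \<le> (\<Sum>h\<in>E. B)"
    using le by (rule sum_mono)
  finally show ?thesis
    using False assms(1) by (simp add: card_gt_0_iff)
qed (use assms in simp)

text \<open>Serves twice: for the thinness of selected tiles, with \<open>E\<close> a union of tile
  shapes, and in \<open>block_ent_folner_limit\<close>, with \<open>E\<close> a window whose
  translates fill \<open>F n\<close>.\<close>

lemma folner_outer:
  assumes F: "folner_seq G F" and E: "finite E" "E \<subseteq> carrier G" and \<delta>: "0 < \<delta>"
  shows "\<forall>\<^sub>F n in sequentially. real (card ((set_inv E <#> F n) - F n)) \<le> \<delta> * real (card (F n))"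
proof -
  have E': "finite (set_inv E)" "set_inv E \<subseteq> carrier G"
    using E finite_set_inv set_inv_closed by auto
  show ?thesis
    using folner_eventually[OF F E' \<delta>]
  proof eventually_elim
    case (elim n)
    have Fn: "finite (F n)"
      using F by (auto simp: folner_seq_def)
    have "(set_inv E <#> F n) - F n \<subseteq> (\<Union>h\<in>set_inv E. (h <# F n) - F n)"
      unfolding set_mult_def l_coset_def by blast
    then have "card ((set_inv E <#> F n) - F n) \<le> card (\<Union>h\<in>set_inv E. (h <# F n) - F n)"
      by (rule card_mono[rotated]) (use E' Fn in \<open>auto simp: l_coset_def\<close>)
    also have "\<dots> \<le> (\<Sum>h\<in>set_inv E. card ((h <# F n) - F n))"
      by (rule card_UN_le[OF E'(1)])
    also have "real \<dots> \<le> \<delta> * real (card (F n))"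
      by (rule sum_translates_bound[OF E'(1)]) (use elim \<delta> in auto)
    finally show ?case by simp
  qed
qed

text \<open>A centre is bad because of some \<open>h \<in> E\<close>, and for fixed \<open>h\<close>
  left multiplication by \<open>h\<close> injects these centres into
  \<open>(h <# F n) - F n\<close>.\<close>

lemma folner_inner:
  assumes F: "folner_seq G F" and E: "finite E" "E \<subseteq> carrier G" and \<delta>: "0 < \<delta>"
  shows "\<forall>\<^sub>F n in sequentially. real (card {a\<in>F n. \<not> E #> a \<subseteq> F n}) \<le> \<delta> * real (card (F n))"
  using folner_eventually[OF F E \<delta>]
proof eventually_elim
  case (elim n)
  have Fn: "finite (F n)" "F n \<subseteq> carrier G"
    using F by (auto simp: folner_seq_def)
  have "{a\<in>F n. \<not> E #> a \<subseteq> F n} \<subseteq> (\<Union>h\<in>E. {a\<in>F n. h \<otimes> a \<notin> F n})"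
    unfolding r_coset_def by blast
  then have "card {a\<in>F n. \<not> E #> a \<subseteq> F n} \<le> card (\<Union>h\<in>E. {a\<in>F n. h \<otimes> a \<notin> F n})"
    by (rule card_mono[rotated]) (use E Fn in auto)
  also have "\<dots> \<le> (\<Sum>h\<in>E. card {a\<in>F n. h \<otimes> a \<notin> F n})"
    by (rule card_UN_le[OF E(1)])
  also have "\<dots> \<le> (\<Sum>h\<in>E. card ((h <# F n) - F n))"
  proof (rule sum_mono)
    fix h assume "h \<in> E"
    then have "inj_on (\<lambda>a. h \<otimes> a) {a\<in>F n. h \<otimes> a \<notin> F n}"
      using E Fn by (intro inj_onI) (auto simp: subset_iff)
    moreover have "(\<lambda>a. h \<otimes> a) ` {a\<in>F n. h \<otimes> a \<notin> F n} \<subseteq> (h <# F n) - F n"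
      by (auto simp: l_coset_def)
    moreover have "finite ((h <# F n) - F n)"
      using Fn by (auto simp: l_coset_def)
    ultimately show "card {a\<in>F n. h \<otimes> a \<notin> F n} \<le> card ((h <# F n) - F n)"
      by (rule card_inj_on_le)
  qed
  finally have "real (card {a\<in>F n. \<not> E #> a \<subseteq> F n}) \<le> real (\<Sum>h\<in>E. card ((h <# F n) - F n))"
    by (simp only: of_nat_le_iff)
  also have "\<dots> \<le> \<delta> * real (card (F n))"
    by (rule sum_translates_bound[OF E(1)]) (use elim \<delta> in auto)
  finally show ?case .
qed

end

section \<open>Entropy of finite-valued functions\<close>

locale full_prob_space = prob_space M for M :: "'x measure" +
  assumes space_UNIV: "space M = UNIV"
begin

definition finite_valued :: "('x \<Rightarrow> 'b) \<Rightarrow> bool" where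
  "finite_valued f \<longleftrightarrow> finite (range f) \<and> (\<forall>u. f -` {u} \<in> events)"

text \<open>Defined through the nonempty fibres, it depends only on the partition that
  \<open>f\<close> induces, not on the values of \<open>f\<close> or their type; joins of partitions
  can then be formed by pairing functions.\<close>

definition ent :: "('x \<Rightarrow> 'b) \<Rightarrow> real" where
  "ent f = shannon_entropy M (range (\<lambda>x. f -` {f x}))"

lemma ent_cong_fibres:
  assumes "\<And>x y. f x = f y \<longleftrightarrow> g x = g y"
  shows "ent f = ent g"
proof -
  have "f -` {f x} = g -` {g x}" for x
    using assms by auto
  then show ?thesis
    by (simp add: ent_def)
qed

lemma ent_eq_sum:
  "ent f = (\<Sum>u\<in>range f. prob (f -` {u}) * - ln (prob (f -` {u})))"
proof -
  have "range (\<lambda>x. f -` {f x}) = (\<lambda>u. f -` {u}) ` range f"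
    by auto
  moreover have "inj_on (\<lambda>u. f -` {u}) (range f)"
    by (auto simp: inj_on_def)
  ultimately show ?thesis
    by (simp add: ent_def shannon_entropy_def sum.reindex sum_negf)
qed

lemma finite_valued_comp:
  assumes "finite_valued f"
  shows "finite_valued (\<lambda>x. h (f x))"
proof -
  have "(\<lambda>x. h (f x)) -` {v} = (\<Union>u\<in>{u\<in>range f. h u = v}. f -` {u})" for v
    by auto
  moreover have "(\<Union>u\<in>{u\<in>range f. h u = v}. f -` {u}) \<in> events" for v
    using assms by (intro sets.finite_UN) (auto simp: finite_valued_def)
  moreover have "finite (range (\<lambda>x. h (f x)))"
    using assms finite_imageI[of "range f" h] by (simp add: finite_valued_def image_image)
  ultimately show ?thesis
    by (simp add: finite_valued_def)
qed

lemma finite_valued_Pair: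
  assumes "finite_valued f" "finite_valued g"
  shows "finite_valued (\<lambda>x. (f x, g x))"
proof -
  have "(\<lambda>x. (f x, g x)) -` {p} = f -` {fst p} \<inter> g -` {snd p}" for p
    by auto
  moreover have "finite (range (\<lambda>x. (f x, g x)))"
    by (rule finite_subset[of _ "range f \<times> range g"]) (use assms in \<open>auto simp: finite_valued_def\<close>)
  ultimately show ?thesis
    using assms by (auto simp: finite_valued_def)
qed

lemma
  fixes c :: "'b \<Rightarrow> real"
  assumes "finite_valued f"
  shows integrable_finite_valued: "integrable M (\<lambda>x. c (f x))"
    and expectation_finite_valued: "expectation (\<lambda>x. c (f x)) = (\<Sum>u\<in>range f. prob (f -` {u}) * c u)"
proof -
  have eq: "(\<lambda>x. c (f x)) = (\<lambda>x. \<Sum>u\<in>range f. c u * indicator (f -` {u}) x)"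
  proof
    fix x
    have "(\<Sum>u\<in>range f. c u * indicator (f -` {u}) x) = (\<Sum>u\<in>range f. if u = f x then c u else 0)"
      by (rule sum.cong) (auto simp: indicator_def)
    then show "c (f x) = (\<Sum>u\<in>range f. c u * indicator (f -` {u}) x)"
      using assms by (simp add: finite_valued_def)
  qed
  have int: "integrable M (\<lambda>x. c u * indicator (f -` {u}) x)" for u
    using assms by (intro integrable_mult_right integrable_real_indicator)
      (auto simp: finite_valued_def emeasure_eq_measure)
  show "integrable M (\<lambda>x. c (f x))"
    unfolding eq by (intro Bochner_Integration.integrable_sum int)
  show "expectation (\<lambda>x. c (f x)) = (\<Sum>u\<in>range f. prob (f -` {u}) * c u)"
    unfolding eq by (subst Bochner_Integration.integral_sum[OF int]) (simp add: space_UNIV mult.commute)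
qed

lemma sum_prob_fibres: "finite_valued f \<Longrightarrow> (\<Sum>u\<in>range f. prob (f -` {u})) = 1"
  using expectation_finite_valued[of f "\<lambda>_. 1"] prob_space by simp

lemma sum_prob_marginal:
  fixes c :: "'c \<Rightarrow> real"
  assumes "finite_valued f"
  shows "(\<Sum>u\<in>range f. prob (f -` {u}) * c (h u))
    = (\<Sum>v\<in>range (\<lambda>x. h (f x)). prob ((\<lambda>x. h (f x)) -` {v}) * c v)"
  using expectation_finite_valued[OF assms, of "\<lambda>u. c (h u)"]
    expectation_finite_valued[OF finite_valued_comp[OF assms], of c h] by simp

lemma prob_fibre_comp_le:
  assumes "finite_valued f"
  shows "prob (f -` {u}) \<le> prob ((\<lambda>x. h (f x)) -` {h u})"
  using finite_valued_comp[OF assms, of h]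
  by (intro finite_measure_mono) (auto simp: finite_valued_def)

lemma sum_prob_fibres_Pair:
  assumes "finite_valued f" "finite_valued g"
  shows "(\<Sum>u\<in>range f. prob ((\<lambda>x. (f x, g x)) -` {(u, v)})) = prob (g -` {v})"
proof -
  have "disjoint_family_on (\<lambda>u. (\<lambda>x. (f x, g x)) -` {(u, v)}) (range f)"
    by (auto simp: disjoint_family_on_def)
  moreover have "(\<Union>u\<in>range f. (\<lambda>x. (f x, g x)) -` {(u, v)}) = g -` {v}"
    by auto
  ultimately show ?thesis
    using assms finite_valued_Pair[OF assms] finite_measure_finite_Union[of "range f" "\<lambda>u. (\<lambda>x. (f x, g x)) -` {(u, v)}"]
    by (simp add: finite_valued_def image_subset_iff)
qed

text \<open>Sum of \<open>p * (ln q - ln p) \<le> q - p\<close>, which is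
  \<open>ln t \<le> t - 1\<close> at \<open>t = q / p\<close>. Total mass at most \<open>1\<close>
  is enough for \<open>q\<close>; positivity is demanded where \<open>f\<close> has mass, since only
  there \<open>ln (q u)\<close> has to be a genuine logarithm.\<close>

lemma gibbs_inequality:
  assumes f: "finite_valued f"
    and q: "\<And>u. u \<in> range f \<Longrightarrow> 0 \<le> q u" "(\<Sum>u\<in>range f. q u) \<le> 1"
      "\<And>u. u \<in> range f \<Longrightarrow> 0 < prob (f -` {u}) \<Longrightarrow> 0 < q u"
  shows "ent f \<le> (\<Sum>u\<in>range f. prob (f -` {u}) * - ln (q u))"
proof -
  have "prob (f -` {u}) * - ln (prob (f -` {u})) \<le> prob (f -` {u}) * - ln (q u) + (q u - prob (f -` {u}))"
    if "u \<in> range f" for u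
  proof (cases "prob (f -` {u}) = 0")
    case True
    then show ?thesis using q(1)[OF that] by simp
  next
    case False
    define p where "p = prob (f -` {u})"
    have pos: "0 < p" "0 < q u"
      using False q(3)[OF that] by (auto simp: p_def zero_less_measure_iff)
    have "p * (ln (q u) - ln p) \<le> p * (q u / p - 1)"
      using pos ln_le_minus_one[of "q u / p"] by (intro mult_left_mono) (auto simp: ln_div)
    also have "\<dots> = q u - p"
      using pos by (simp add: field_simps)
    finally show ?thesis
      by (simp add: p_def algebra_simps)
  qed
  then have "ent f \<le> (\<Sum>u\<in>range f. prob (f -` {u}) * - ln (q u) + (q u - prob (f -` {u})))"
    unfolding ent_eq_sum by (rule sum_mono)
  also have "\<dots> = (\<Sum>u\<in>range f. prob (f -` {u}) * - ln (q u)) + ((\<Sum>u\<in>range f. q u) - 1)"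
    by (simp only: sum.distrib sum_subtractf sum_prob_fibres[OF f])
  finally show ?thesis
    using q(2) by simp
qed

lemma ent_comp_le:
  assumes "finite_valued f"
  shows "ent (\<lambda>x. h (f x)) \<le> ent f"
proof -
  have "ent (\<lambda>x. h (f x)) = (\<Sum>u\<in>range f. prob (f -` {u}) * - ln (prob ((\<lambda>x. h (f x)) -` {h u})))"
    unfolding ent_eq_sum
    using sum_prob_marginal[OF assms, of "\<lambda>v. - ln (prob ((\<lambda>x. h (f x)) -` {v}))" h] by simp
  also have "\<dots> \<le> ent f"
    unfolding ent_eq_sum
  proof (rule sum_mono)
    fix u
    show "prob (f -` {u}) * - ln (prob ((\<lambda>x. h (f x)) -` {h u})) \<le> prob (f -` {u}) * - ln (prob (f -` {u}))"
    proof (cases "prob (f -` {u}) = 0")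
      case False
      then have "0 < prob (f -` {u})"
        by (simp add: zero_less_measure_iff)
      with prob_fibre_comp_le[OF assms, of u h]
      have "ln (prob (f -` {u})) \<le> ln (prob ((\<lambda>x. h (f x)) -` {h u}))"
        by simp
      then show ?thesis
        by (intro mult_left_mono) auto
    qed simp
  qed
  finally show ?thesis .
qed

text \<open>The comparison distribution makes \<open>f\<close> and \<open>g\<close> conditionally independent given \<open>k\<close>.\<close>

lemma ent_strong_subadditive:
  fixes f :: "'x \<Rightarrow> 'b" and g :: "'x \<Rightarrow> 'c" and k :: "'x \<Rightarrow> 'd"
  assumes f: "finite_valued f" and g: "finite_valued g" and k: "finite_valued k"
  shows "ent (\<lambda>x. (f x, g x, k x)) + ent k \<le> ent (\<lambda>x. (f x, k x)) + ent (\<lambda>x. (g x, k x))"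
proof -
  let ?t = "\<lambda>x. (f x, g x, k x)" and ?fk = "\<lambda>x. (f x, k x)" and ?gk = "\<lambda>x. (g x, k x)"
  define P where "P p = prob (?fk -` {p})" for p
  define Q where "Q p = prob (?gk -` {p})" for p
  define R where "R w = prob (k -` {w})" for w
  have t: "finite_valued ?t"
    by (intro finite_valued_Pair f g k)
  define q where "q = (\<lambda>(u, v, w). P (u, w) * Q (v, w) / R w)"
  have nonneg: "0 \<le> P p" "0 \<le> Q p'" "0 \<le> R w" for p p' w
    by (auto simp: P_def Q_def R_def)
  have le: "prob (?t -` {(u, v, w)}) \<le> P (u, w)" "prob (?t -` {(u, v, w)}) \<le> Q (v, w)"
      "prob (?t -` {(u, v, w)}) \<le> R w" for u v w
    unfolding P_def Q_def R_def
    using prob_fibre_comp_le[OF t, of "(u, v, w)" "\<lambda>(u, v, w). (u, w)"]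
      prob_fibre_comp_le[OF t, of "(u, v, w)" "\<lambda>(u, v, w). (v, w)"]
      prob_fibre_comp_le[OF t, of "(u, v, w)" "\<lambda>(u, v, w). w"] by auto
  have "(\<Sum>p\<in>range ?t. q p) \<le> (\<Sum>p\<in>range f \<times> range g \<times> range k. q p)"
    by (rule sum_mono2) (use f g k nonneg in \<open>auto simp: finite_valued_def q_def\<close>)
  also have "\<dots> = (\<Sum>u\<in>range f. \<Sum>v\<in>range g. \<Sum>w\<in>range k. P (u, w) * Q (v, w) / R w)"
    by (simp add: q_def sum.cartesian_product)
  also have "\<dots> = (\<Sum>u\<in>range f. \<Sum>w\<in>range k. \<Sum>v\<in>range g. P (u, w) * Q (v, w) / R w)"
    by (rule sum.cong[OF refl], rule sum.swap)
  also have "\<dots> = (\<Sum>w\<in>range k. \<Sum>u\<in>range f. \<Sum>v\<in>range g. P (u, w) * Q (v, w) / R w)"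
    by (rule sum.swap)
  also have "\<dots> = (\<Sum>w\<in>range k. (\<Sum>u\<in>range f. P (u, w)) * (\<Sum>v\<in>range g. Q (v, w)) / R w)"
    by (simp add: sum_product sum_divide_distrib)
  also have "\<dots> = (\<Sum>w\<in>range k. R w * R w / R w)"
    unfolding P_def Q_def R_def sum_prob_fibres_Pair[OF f k] sum_prob_fibres_Pair[OF g k] ..
  \<comment> \<open>Valid also where \<open>R w = 0\<close>, since division by zero yields
    \<open>0\<close>.\<close>
  also have "\<dots> = (\<Sum>w\<in>range k. R w)"
    by simp
  also have "\<dots> = 1"
    unfolding R_def by (rule sum_prob_fibres[OF k])
  finally have "(\<Sum>p\<in>range ?t. q p) \<le> 1" .
  moreover have "0 \<le> q p" for p
    using nonneg by (auto simp: q_def split: prod.splits)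
  moreover have "0 < q p" if "0 < prob (?t -` {p})" for p
  proof -
    obtain u v w where p: "p = (u, v, w)"
      using prod_cases3 by blast
    have "0 < P (u, w)" "0 < Q (v, w)" "0 < R w"
      using that[unfolded p] le less_le_trans by blast+
    then show ?thesis
      by (simp add: p q_def)
  qed
  ultimately have "ent ?t \<le> (\<Sum>p\<in>range ?t. prob (?t -` {p}) * - ln (q p))"
    by (intro gibbs_inequality t) auto
  also have "\<dots> = (\<Sum>p\<in>range ?t. prob (?t -` {p}) * - ln (P (case p of (u, v, w) \<Rightarrow> (u, w)))
      + prob (?t -` {p}) * - ln (Q (case p of (u, v, w) \<Rightarrow> (v, w)))
      - prob (?t -` {p}) * - ln (R (case p of (u, v, w) \<Rightarrow> w)))"
  proof (rule sum.cong[OF refl])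
    fix p :: "'b \<times> 'c \<times> 'd"
    obtain u v w where p: "p = (u, v, w)"
      using prod_cases3 by blast
    show "prob (?t -` {p}) * - ln (q p) = prob (?t -` {p}) * - ln (P (case p of (u, v, w) \<Rightarrow> (u, w)))
      + prob (?t -` {p}) * - ln (Q (case p of (u, v, w) \<Rightarrow> (v, w)))
      - prob (?t -` {p}) * - ln (R (case p of (u, v, w) \<Rightarrow> w))"
    proof (cases "prob (?t -` {p}) = 0")
      case False
      then have "0 < prob (?t -` {(u, v, w)})"
        by (simp add: p zero_less_measure_iff)
      then have "0 < P (u, w)" "0 < Q (v, w)" "0 < R w"
        using le less_le_trans by blast+
      then have "ln (q p) = ln (P (u, w)) + ln (Q (v, w)) - ln (R w)"
        by (simp add: p q_def ln_div ln_mult)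
      then show ?thesis
        by (simp only: p fst_conv snd_conv prod.case) (simp add: algebra_simps)
    qed simp
  qed
  also have "\<dots> = ent ?fk + ent ?gk - ent k"
    unfolding sum.distrib sum_subtractf
    using sum_prob_marginal[OF t, of "\<lambda>p. - ln (P p)" "\<lambda>(u, v, w). (u, w)"]
      sum_prob_marginal[OF t, of "\<lambda>p. - ln (Q p)" "\<lambda>(u, v, w). (v, w)"]
      sum_prob_marginal[OF t, of "\<lambda>p. - ln (R p)" "\<lambda>(u, v, w). w"]
    by (simp add: ent_eq_sum P_def Q_def R_def)
  finally show ?thesis
    by simp
qed

text \<open>Gibbs inequality for the pair, tested against the probability of the value
  \<open>v\<close> of \<open>g\<close> times \<open>w u v / Z\<close>: \<open>w\<close> is an
  unnormalised code for \<open>f\<close> that may depend on \<open>g\<close>. The function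
  \<open>b\<close> bounds the code length pointwise and need not factor through \<open>f\<close> and
  \<open>g\<close>.\<close>

lemma ent_le_conditional_code:
  fixes w :: "'b \<Rightarrow> 'c \<Rightarrow> real"
  assumes f: "finite_valued f" and g: "finite_valued g"
    and w: "\<And>u v. 0 \<le> w u v" "\<And>x. 0 < w (f x) (g x)"
    and Z: "\<And>v. v \<in> range g \<Longrightarrow> (\<Sum>u\<in>range f. w u v) \<le> Z" "0 < Z"
    and b: "integrable M b" "\<And>x. - ln (w (f x) (g x)) \<le> b x"
  shows "ent f \<le> ent g + expectation b + ln Z"
proof -
  let ?t = "\<lambda>x. (f x, g x)"
  have t: "finite_valued ?t"
    by (intro finite_valued_Pair f g)
  define R where "R v = prob (g -` {v})" for v
  define q where "q = (\<lambda>(u, v). R v * w u v / Z)"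
  have le: "prob (?t -` {(u, v)}) \<le> R v" for u v
    using prob_fibre_comp_le[OF t, of "(u, v)" snd] by (simp add: R_def)
  have "(\<Sum>p\<in>range ?t. q p) \<le> (\<Sum>p\<in>range f \<times> range g. q p)"
    by (rule sum_mono2) (use f g w Z(2) in \<open>auto simp: finite_valued_def q_def R_def\<close>)
  also have "\<dots> = (\<Sum>u\<in>range f. \<Sum>v\<in>range g. R v * w u v / Z)"
    by (simp add: q_def sum.cartesian_product)
  also have "\<dots> = (\<Sum>v\<in>range g. \<Sum>u\<in>range f. R v * w u v / Z)"
    by (rule sum.swap)
  also have "\<dots> = (\<Sum>v\<in>range g. R v * ((\<Sum>u\<in>range f. w u v) / Z))"
    by (simp add: sum_distrib_left sum_divide_distrib)
  also have "\<dots> \<le> (\<Sum>v\<in>range g. R v * 1)"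
    using Z by (intro sum_mono mult_left_mono) (auto simp: R_def)
  also have "\<dots> = 1"
    using sum_prob_fibres[OF g] by (simp add: R_def)
  finally have "(\<Sum>p\<in>range ?t. q p) \<le> 1" .
  moreover have "0 \<le> q p" for p
    using w Z(2) by (auto simp: q_def R_def split: prod.splits)
  moreover have "0 < q p" if "p \<in> range ?t" "0 < prob (?t -` {p})" for p
  proof -
    obtain x where p: "p = (f x, g x)"
      using \<open>p \<in> range ?t\<close> by blast
    have "0 < R (g x)"
      using \<open>0 < prob (?t -` {p})\<close> le unfolding p by (rule less_le_trans)
    then show ?thesis
      using w(2) Z(2) by (simp add: p q_def)
  qed
  ultimately have "ent ?t \<le> (\<Sum>p\<in>range ?t. prob (?t -` {p}) * - ln (q p))"
    by (intro gibbs_inequality t) auto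
  also have "\<dots> = (\<Sum>p\<in>range ?t. prob (?t -` {p}) * - ln (R (snd p))
      + prob (?t -` {p}) * - ln (w (fst p) (snd p)) + prob (?t -` {p}) * ln Z)"
  proof (rule sum.cong[OF refl])
    fix p assume "p \<in> range ?t"
    then obtain x where p: "p = (f x, g x)"
      by blast
    show "prob (?t -` {p}) * - ln (q p) = prob (?t -` {p}) * - ln (R (snd p))
      + prob (?t -` {p}) * - ln (w (fst p) (snd p)) + prob (?t -` {p}) * ln Z"
    proof (cases "prob (?t -` {p}) = 0")
      case False
      then have "0 < prob (?t -` {(f x, g x)})"
        by (simp add: p zero_less_measure_iff)
      then have "0 < R (g x)"
        using le less_le_trans by blast
      then have lnq: "ln (q (f x, g x)) = ln (R (g x)) + ln (w (f x) (g x)) - ln Z"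
        using w(2)[of x] Z(2) by (simp add: q_def ln_div ln_mult)
      show ?thesis
        unfolding p fst_conv snd_conv lnq by (simp add: algebra_simps)
    qed simp
  qed
  also have "\<dots> = ent g + expectation (\<lambda>x. - ln (w (f x) (g x))) + ln Z"
    unfolding sum.distrib
    using sum_prob_marginal[OF t, of "\<lambda>p. - ln (R p)" snd]
      expectation_finite_valued[OF t, of "\<lambda>p. - ln (w (fst p) (snd p))"]
      sum_prob_fibres[OF t]
    by (simp add: ent_eq_sum R_def flip: sum_distrib_right)
  also have "expectation (\<lambda>x. - ln (w (f x) (g x))) \<le> expectation b"
    using integrable_finite_valued[OF t, of "\<lambda>p. - ln (w (fst p) (snd p))"] b
    by (intro integral_mono) auto
  finally have "ent ?t \<le> ent g + expectation b + ln Z"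
    by simp
  moreover have "ent f \<le> ent ?t"
    using ent_comp_le[OF t, of fst] by simp
  ultimately show ?thesis
    by simp
qed

end

section \<open>Entropy of itineraries\<close>

text \<open>The elements of \<open>W\<close> are added one at a time. By diminishing increments,
  adding \<open>i\<close> to \<open>W\<close> gains at most as much as adding it to
  \<open>S t \<inter> W\<close>, and exactly \<open>m\<close> of the sets contain
  \<open>i\<close>.\<close>

lemma shearer:
  fixes h :: "'a set \<Rightarrow> real"
  assumes "h {} = 0"
    and sub: "\<And>S S' i. S \<subseteq> S' \<Longrightarrow> S' \<subseteq> V \<Longrightarrow> finite S' \<Longrightarrow> i \<in> V \<Longrightarrow> i \<notin> S' \<Longrightarrow>
      h (insert i S') - h S' \<le> h (insert i S) - h S"
    and W: "finite W" "W \<subseteq> V" and T: "finite T"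
    and m: "\<And>w. w \<in> W \<Longrightarrow> card {t\<in>T. w \<in> S t} = m"
  shows "real m * h W \<le> (\<Sum>t\<in>T. h (S t \<inter> W))"
  using W m
proof (induction W rule: finite_induct)
  case empty
  then show ?case
    using assms(1) by simp
next
  case (insert i W)
  have "real m * (h (insert i W) - h W) = (\<Sum>t\<in>{t\<in>T. i \<in> S t}. h (insert i W) - h W)"
    using insert.prems(2)[of i] by simp
  also have "\<dots> \<le> (\<Sum>t\<in>{t\<in>T. i \<in> S t}. h (insert i (S t \<inter> W)) - h (S t \<inter> W))"
    by (rule sum_mono, rule sub) (use insert in auto)
  also have "\<dots> = (\<Sum>t\<in>T. if i \<in> S t then h (insert i (S t \<inter> W)) - h (S t \<inter> W) else 0)"
    using T by (rule sum.inter_filter)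
  also have "\<dots> = (\<Sum>t\<in>T. h (S t \<inter> insert i W) - h (S t \<inter> W))"
    by (rule sum.cong) auto
  finally have "real m * (h (insert i W) - h W) \<le> (\<Sum>t\<in>T. h (S t \<inter> insert i W)) - (\<Sum>t\<in>T. h (S t \<inter> W))"
    by (simp add: sum_subtractf)
  moreover have "real m * h W \<le> (\<Sum>t\<in>T. h (S t \<inter> W))"
    using insert by auto
  ultimately show ?case
    by (simp add: algebra_simps)
qed

locale measure_preserving_action = full_prob_space M + act: group_action G UNIV \<phi>
  for M :: "'x measure" and G :: "('g, 'm) monoid_scheme" (structure) and \<phi> +
  assumes measurable_act: "g \<in> carrier G \<Longrightarrow> \<phi> g \<in> measurable M M"
    and invariant: "g \<in> carrier G \<Longrightarrow> distr M M (\<phi> g) = M"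
begin

sublocale group G
  by (metis act.group_hom group_hom_def)

lemma act_mult: "g \<in> carrier G \<Longrightarrow> h \<in> carrier G \<Longrightarrow> \<phi> (g \<otimes> h) x = \<phi> g (\<phi> h x)"
  by (rule act.composition_rule) auto

lemma prob_vimage_act:
  assumes "g \<in> carrier G" "A \<in> events"
  shows "prob (\<phi> g -` A) = prob A" and "\<phi> g -` A \<in> events"
  using measure_distr[OF measurable_act[OF assms(1)] assms(2)] invariant[OF assms(1)]
    measurable_sets[OF measurable_act[OF assms(1)] assms(2)]
  by (simp_all add: space_UNIV)

lemma finite_valued_act:
  assumes "finite_valued f" "g \<in> carrier G"
  shows "finite_valued (\<lambda>x. f (\<phi> g x))"
proof -
  have "(\<lambda>x. f (\<phi> g x)) -` {u} = \<phi> g -` (f -` {u})" for u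
    by auto
  moreover have "finite (range (\<lambda>x. f (\<phi> g x)))"
    by (rule finite_subset[of _ "range f"]) (use assms in \<open>auto simp: finite_valued_def\<close>)
  ultimately show ?thesis
    using assms prob_vimage_act(2) by (simp add: finite_valued_def)
qed

lemma ent_act:
  assumes "finite_valued f" "g \<in> carrier G"
  shows "ent (\<lambda>x. f (\<phi> g x)) = ent f"
proof -
  have "surj (\<phi> g)"
    using act.surj_prop[OF assms(2)] .
  then have "range (\<lambda>x. f (\<phi> g x)) = range f"
    by (metis image_image)
  moreover have "prob ((\<lambda>x. f (\<phi> g x)) -` {u}) = prob (f -` {u})" for u
  proof -
    have "(\<lambda>x. f (\<phi> g x)) -` {u} = \<phi> g -` (f -` {u})"
      by auto
    then show ?thesis
      using assms prob_vimage_act(1) by (simp add: finite_valued_def)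
  qed
  ultimately show ?thesis
    by (simp add: ent_eq_sum)
qed

definition itinerary :: "('x \<Rightarrow> 'b) \<Rightarrow> 'g set \<Rightarrow> 'x \<Rightarrow> 'g \<Rightarrow> 'b" where
  "itinerary f E x = restrict (\<lambda>g. f (\<phi> g x)) E"

lemma itinerary_eq_iff: "itinerary f E x = itinerary f E y \<longleftrightarrow> (\<forall>g\<in>E. f (\<phi> g x) = f (\<phi> g y))"
  unfolding itinerary_def by (auto simp: restrict_def fun_eq_iff)

lemma finite_valued_itinerary:
  assumes "finite_valued f" "finite E" "E \<subseteq> carrier G"
  shows "finite_valued (itinerary f E)"
  using assms(2,3)
proof (induction E rule: finite_induct)
  case empty
  have "itinerary f {} = (\<lambda>x _. undefined)"
    by (simp add: itinerary_def fun_eq_iff)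
  moreover have "(\<lambda>_. c) -` {u} = (if u = c then UNIV else {})" for c u :: "'g \<Rightarrow> 'b"
    by auto
  ultimately show ?case
    using sets.top[of M] by (simp add: finite_valued_def space_UNIV)
next
  case (insert g E)
  have eq: "itinerary f (insert g E) = (\<lambda>x. (\<lambda>(u, v). v(g := u)) (f (\<phi> g x), itinerary f E x))"
    using insert(2) by (auto simp: itinerary_def restrict_def fun_eq_iff)
  show ?case
    unfolding eq
    by (rule finite_valued_comp, rule finite_valued_Pair) (use insert finite_valued_act[OF assms(1)] in auto)
qed

definition block_ent :: "('x \<Rightarrow> 'b) \<Rightarrow> 'g set \<Rightarrow> real" where
  "block_ent f E = ent (itinerary f E)"

lemma block_ent_empty: "block_ent f {} = 0"
proof -
  have "ent (itinerary f {}) = ent (\<lambda>x. ())"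
    by (rule ent_cong_fibres) (simp add: itinerary_eq_iff)
  also have "\<dots> = 0"
    using prob_space by (simp add: ent_eq_sum space_UNIV)
  finally show ?thesis
    by (simp add: block_ent_def)
qed

lemma block_ent_mono:
  assumes "finite_valued f" "E \<subseteq> E'" "finite E'" "E' \<subseteq> carrier G"
  shows "block_ent f E \<le> block_ent f E'"
proof -
  have "itinerary f E = (\<lambda>x. restrict (itinerary f E' x) E)"
    using assms(2) by (auto simp: itinerary_def restrict_def fun_eq_iff)
  then show ?thesis
    unfolding block_ent_def
    using ent_comp_le[OF finite_valued_itinerary[OF assms(1,3,4)], of "\<lambda>u. restrict u E"] by simp
qed

text \<open>Strong subadditivity conditioned on the itinerary along \<open>E\<close>; as
  \<open>E \<subseteq> E'\<close>, this information is already part of the itinerary along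
  \<open>E'\<close>.\<close>

lemma block_ent_submodular:
  assumes f: "finite_valued f" and "E \<subseteq> E'" "E' \<subseteq> carrier G" "finite E'" "g \<in> carrier G" "g \<notin> E'"
  shows "block_ent f (insert g E') - block_ent f E' \<le> block_ent f (insert g E) - block_ent f E"
proof -
  have fin: "finite E"
    using assms finite_subset by blast
  have "ent (\<lambda>x. (f (\<phi> g x), itinerary f E' x, itinerary f E x)) + ent (itinerary f E)
      \<le> ent (\<lambda>x. (f (\<phi> g x), itinerary f E x)) + ent (\<lambda>x. (itinerary f E' x, itinerary f E x))"
    by (rule ent_strong_subadditive)
      (use assms fin finite_valued_act[OF f] finite_valued_itinerary[OF f] in auto)
  moreover have "ent (\<lambda>x. (f (\<phi> g x), itinerary f E' x, itinerary f E x)) = block_ent f (insert g E')"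
    unfolding block_ent_def by (rule ent_cong_fibres) (use assms(2) in \<open>auto simp: itinerary_eq_iff\<close>)
  moreover have "ent (\<lambda>x. (f (\<phi> g x), itinerary f E x)) = block_ent f (insert g E)"
    unfolding block_ent_def by (rule ent_cong_fibres) (auto simp: itinerary_eq_iff)
  moreover have "ent (\<lambda>x. (itinerary f E' x, itinerary f E x)) = block_ent f E'"
    unfolding block_ent_def by (rule ent_cong_fibres) (use assms(2) in \<open>auto simp: itinerary_eq_iff\<close>)
  ultimately show ?thesis
    by (simp add: block_ent_def)
qed

lemma block_ent_singleton:
  assumes "finite_valued f" "g \<in> carrier G"
  shows "block_ent f {g} = ent f"
proof -
  have "block_ent f {g} = ent (\<lambda>x. f (\<phi> g x))"
    unfolding block_ent_def by (rule ent_cong_fibres) (simp add: itinerary_eq_iff)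
  then show ?thesis
    using ent_act[OF assms] by simp
qed

lemma block_ent_le_card:
  assumes "finite_valued f" "finite E" "E \<subseteq> carrier G"
  shows "block_ent f E \<le> real (card E) * ent f"
  using assms(2,3)
proof (induction E rule: finite_induct)
  case empty
  then show ?case by (simp add: block_ent_empty)
next
  case (insert g E)
  have "block_ent f (insert g E) - block_ent f E \<le> block_ent f (insert g {}) - block_ent f {}"
    by (rule block_ent_submodular[OF assms(1)]) (use insert in auto)
  then show ?case
    using insert block_ent_singleton[OF assms(1), of g] by (simp add: block_ent_empty algebra_simps)
qed

text \<open>Reading \<open>f\<close> along \<open>E #> a\<close> from \<open>x\<close> is reading it
  along \<open>E\<close> from \<open>\<phi> a x\<close>, whose law is the same by invariance. This
  is why tiles are right cosets.\<close>

lemma block_ent_r_coset: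
  assumes "finite_valued f" "finite E" "E \<subseteq> carrier G" "a \<in> carrier G"
  shows "block_ent f (E #> a) = block_ent f E"
proof -
  have "ent (itinerary f (E #> a)) = ent (\<lambda>x. itinerary f E (\<phi> a x))"
    by (rule ent_cong_fibres)
       (use assms act_mult in \<open>auto simp: itinerary_eq_iff r_coset_def subset_iff\<close>)
  also have "\<dots> = ent (itinerary f E)"
    by (rule ent_act[OF finite_valued_itinerary[OF assms(1-3)] assms(4)])
  finally show ?thesis
    by (simp add: block_ent_def)
qed

text \<open>The centres are \<open>inv h \<otimes> w\<close> for \<open>h \<in> E\<close>, pairwise
  distinct, and \<open>w \<in> W\<close> puts all of them into
  \<open>set_inv E <#> W\<close>.\<close>

lemma card_translates_containing:
  assumes "finite E" "E \<subseteq> carrier G" "W \<subseteq> carrier G" "w \<in> W"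
  shows "card {a \<in> set_inv E <#> W. w \<in> E #> a} = card E"
proof -
  have "{a \<in> set_inv E <#> W. w \<in> E #> a} = (\<lambda>h. inv h \<otimes> w) ` E"
  proof (rule Set.set_eqI, rule iffI)
    fix a assume "a \<in> {a \<in> set_inv E <#> W. w \<in> E #> a}"
    then obtain h h' u where "h \<in> E" "w = h \<otimes> a" "h' \<in> E" "u \<in> W" "a = inv h' \<otimes> u"
      unfolding r_coset_def set_mult_def SET_INV_def by auto
    then show "a \<in> (\<lambda>h. inv h \<otimes> w) ` E"
      using assms by (intro image_eqI[of _ _ h]) (auto simp: inv_solve_left subset_iff)
  next
    fix a assume "a \<in> (\<lambda>h. inv h \<otimes> w) ` E"
    then obtain h where h: "h \<in> E" "a = inv h \<otimes> w" by blast
    then have "w = h \<otimes> a"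
      using assms by (simp add: m_assoc[symmetric] subset_iff)
    then show "a \<in> {a \<in> set_inv E <#> W. w \<in> E #> a}"
      using h assms(4) unfolding r_coset_def set_mult_def SET_INV_def by blast
  qed
  moreover have "inj_on (\<lambda>h. inv h \<otimes> w) E"
    using assms by (intro inj_onI) (metis inv_closed inv_inv right_cancel subsetD)
  ultimately show ?thesis
    by (simp add: card_image)
qed

text \<open>Shearer's inequality applies because the translates of \<open>E\<close> cover every point of \<open>W\<close> exactly
  \<open>card E\<close> times.\<close>

lemma block_ent_le_translates:
  assumes f: "finite_valued f" and E: "finite E" "E \<subseteq> carrier G" and W: "finite W" "W \<subseteq> carrier G"
  shows "real (card E) * block_ent f W \<le> real (card (set_inv E <#> W)) * block_ent f E"
proof -
  have T: "finite (set_inv E <#> W)" "set_inv E <#> W \<subseteq> carrier G"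
    using E W finite_set_inv finite_set_mult set_inv_closed set_mult_closed by auto
  have "real (card E) * block_ent f W \<le> (\<Sum>a\<in>set_inv E <#> W. block_ent f ((E #> a) \<inter> W))"
    by (rule shearer[where V = "carrier G"])
       (use block_ent_empty block_ent_submodular[OF f] W T card_translates_containing[OF E W(2)] in auto)
  also have "\<dots> \<le> (\<Sum>a\<in>set_inv E <#> W. block_ent f E)"
  proof (rule sum_mono)
    fix a assume "a \<in> set_inv E <#> W"
    then have a: "a \<in> carrier G" using T by blast
    have "block_ent f ((E #> a) \<inter> W) \<le> block_ent f (E #> a)"
      by (rule block_ent_mono[OF f]) (use E a finite_r_coset r_coset_subset_G in auto)
    then show "block_ent f ((E #> a) \<inter> W) \<le> block_ent f E"
      using block_ent_r_coset[OF f E a] by simp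
  qed
  finally show ?thesis by simp
qed

end

section \<open>Entropy per site as an infimum over windows, and partitions as functions\<close>

context measure_preserving_action
begin

lemma block_ent_nonneg:
  "finite_valued f \<Longrightarrow> finite E \<Longrightarrow> E \<subseteq> carrier G \<Longrightarrow> 0 \<le> block_ent f E"
  using block_ent_mono[of f "{}" E] by (simp add: block_ent_empty)

text \<open>\<open>L\<close> is the infimum of the entropy per site over all finite windows. A
  window \<open>W\<close> close to it is spread over \<open>F n\<close> by
  \<open>block_ent_le_translates\<close>, with about \<open>card (F n)\<close> translates because
  \<open>F n\<close> is almost invariant.\<close>

lemma block_ent_folner_limit:
  assumes f: "finite_valued f" and F: "folner_seq G F"
  obtains L where "(\<lambda>n. block_ent f (F n) / real (card (F n))) \<longlonglongrightarrow> L"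
    and "\<And>W. finite W \<Longrightarrow> W \<noteq> {} \<Longrightarrow> W \<subseteq> carrier G \<Longrightarrow> L \<le> block_ent f W / real (card W)"
proof -
  define \<W> where "\<W> = {W. finite W \<and> W \<noteq> {} \<and> W \<subseteq> carrier G}"
  define v where "v W = block_ent f W / real (card W)" for W
  define L where "L = (INF W\<in>\<W>. v W)"
  have F\<W>: "F n \<in> \<W>" for n
    using F by (auto simp: folner_seq_def \<W>_def)
  have v_nonneg: "0 \<le> v W" if "W \<in> \<W>" for W
    using that block_ent_nonneg[OF f] by (simp add: v_def \<W>_def)
  have bdd: "bdd_below (v ` \<W>)"
    using v_nonneg by (intro bdd_belowI[of _ 0]) auto
  have L_le: "L \<le> v W" if "W \<in> \<W>" for W
    unfolding L_def using bdd that by (rule cINF_lower)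
  have "(\<lambda>n. v (F n)) \<longlonglongrightarrow> L"
  proof (rule order_tendstoI)
    fix a assume "a < L"
    then show "\<forall>\<^sub>F n in sequentially. a < v (F n)"
      using L_le[OF F\<W>] by (intro always_eventually allI) (rule less_le_trans)
  next
    fix a assume "L < a"
    then obtain W where W: "W \<in> \<W>" "v W < a"
      unfolding L_def using cINF_less_iff[OF _ bdd, of a] F\<W> by auto
    \<comment> \<open>Makes \<open>\<delta> * v W\<close> at most half the gap
      \<open>a - v W\<close>; the \<open>+ 1\<close> covers the case \<open>v W = 0\<close>.\<close>
    define \<delta> where "\<delta> = (a - v W) / (2 * (v W + 1))"
    have \<delta>: "0 < \<delta>"
      using W v_nonneg by (auto simp: \<delta>_def add_nonneg_pos)
    have "(1 + \<delta>) * v W < a"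
    proof -
      have "\<delta> * v W \<le> \<delta> * (v W + 1)"
        using \<delta> by simp
      also have "\<dots> = (a - v W) / 2"
        using v_nonneg[OF W(1)] by (simp add: \<delta>_def field_simps)
      finally show ?thesis
        using W(2) by (simp add: algebra_simps)
    qed
    have "finite W" "W \<noteq> {}" "W \<subseteq> carrier G"
      using W by (auto simp: \<W>_def)
    from folner_outer[OF F \<open>finite W\<close> \<open>W \<subseteq> carrier G\<close> \<delta>]
    show "\<forall>\<^sub>F n in sequentially. v (F n) < a"
    proof eventually_elim
      case (elim n)
      have Fn: "finite (F n)" "F n \<noteq> {}" "F n \<subseteq> carrier G"
        using F\<W> by (auto simp: \<W>_def)
      have pos: "0 < real (card (F n))" "0 < real (card W)"
        using Fn \<open>finite W\<close> \<open>W \<noteq> {}\<close> by (auto simp: card_gt_0_iff)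
      have "card (set_inv W <#> F n) \<le> card (F n \<union> ((set_inv W <#> F n) - F n))"
        by (rule card_mono) (use Fn \<open>finite W\<close> finite_set_inv finite_set_mult in auto)
      also have "\<dots> \<le> card (F n) + card ((set_inv W <#> F n) - F n)"
        by (rule card_Un_le)
      finally have "real (card (set_inv W <#> F n)) \<le> (1 + \<delta>) * real (card (F n))"
        using elim by (simp add: algebra_simps)
      then have "real (card (set_inv W <#> F n)) * block_ent f W \<le> (1 + \<delta>) * real (card (F n)) * block_ent f W"
        using block_ent_nonneg[OF f \<open>finite W\<close> \<open>W \<subseteq> carrier G\<close>] by (intro mult_right_mono)
      then have "real (card W) * block_ent f (F n) \<le> (1 + \<delta>) * real (card (F n)) * block_ent f W"
        using block_ent_le_translates[OF f \<open>finite W\<close> \<open>W \<subseteq> carrier G\<close> Fn(1,3)] by linarith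
      then have "v (F n) \<le> (1 + \<delta>) * v W"
        using pos by (simp add: v_def field_simps)
      then show ?case
        using \<open>(1 + \<delta>) * v W < a\<close> by linarith
    qed
  qed
  then show thesis
    using L_le by (intro that[of L]) (auto simp: v_def \<W>_def)
qed

definition cell :: "'x set set \<Rightarrow> 'x \<Rightarrow> 'x set" where
  "cell P x = (THE A. A \<in> P \<and> x \<in> A)"

lemma
  assumes "partition_on UNIV P"
  shows cell_eq: "A \<in> P \<Longrightarrow> x \<in> A \<Longrightarrow> cell P x = A"
    and cell_in: "cell P x \<in> P" and in_cell: "x \<in> cell P x"
proof -
  have uniq: "A = B" if "A \<in> P" "B \<in> P" "x \<in> A" "x \<in> B" for A B
    using that disjointD[OF partition_onD2[OF assms], of A B] by blast
  show *: "cell P x = A" if "A \<in> P" "x \<in> A" for A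
    unfolding cell_def by (rule the_equality) (use that uniq in auto)
  obtain A where "A \<in> P" "x \<in> A"
    using partition_onD1[OF assms] by auto
  then show "cell P x \<in> P" "x \<in> cell P x"
    using *[of A] by simp_all
qed

lemma finite_valued_cell:
  assumes "finite_measurable_partition M P"
  shows "finite_valued (cell P)"
proof -
  have P: "finite P" "P \<subseteq> events" "partition_on UNIV P"
    using assms by (auto simp: finite_measurable_partition_def space_UNIV)
  have "cell P -` {A} = (if A \<in> P then A else {})" for A
    using cell_eq[OF P(3)] cell_in[OF P(3)] in_cell[OF P(3)] by auto
  moreover have "range (cell P) \<subseteq> P"
    using cell_in[OF P(3)] by auto
  ultimately show ?thesis
    using P(1,2) finite_subset by (auto simp: finite_valued_def)
qed

text \<open>A fibre of the itinerary is an intersection of pulled back cells. The refinement chooses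
  one member from each partition in a set, so elements \<open>g\<close> with the same pulled back
  partition share their choice; the result is the same, as the member containing a given point is
  unique.\<close>

lemma refined_partition_eq:
  assumes P: "partition_on UNIV P"
  shows "refined_partition \<phi> E P = range (\<lambda>x. itinerary (cell P) E -` {itinerary (cell P) E x})"
proof -
  let ?Q = "\<lambda>g. (\<lambda>A. \<phi> g -` A) ` P"
  have member: "B = \<phi> g -` cell P (\<phi> g x)" if "B \<in> ?Q g" "x \<in> B" for B g x
    using that cell_eq[OF P] by auto
  have fibre: "itinerary (cell P) E -` {itinerary (cell P) E x} = (\<Inter>g\<in>E. \<phi> g -` cell P (\<phi> g x))" for x
  proof -
    have "cell P (\<phi> g y) = cell P (\<phi> g x) \<longleftrightarrow> \<phi> g y \<in> cell P (\<phi> g x)" for g y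
      using cell_eq[OF P cell_in[OF P]] in_cell[OF P] by metis
    then show ?thesis
      by (auto simp: itinerary_eq_iff)
  qed
  show ?thesis
    unfolding fibre refined_partition_def
  proof (rule Set.set_eqI, rule iffI)
    fix X assume "X \<in> common_refinement (?Q ` E)"
    then obtain f x where f: "f \<in> (\<Pi> Q\<in>?Q ` E. Q)" "X = \<Inter> (f ` ?Q ` E)" "x \<in> X"
      unfolding common_refinement by auto
    have "f (?Q g) = \<phi> g -` cell P (\<phi> g x)" if "g \<in> E" for g
      by (rule member) (use f that in auto)
    then have "X = (\<Inter>g\<in>E. \<phi> g -` cell P (\<phi> g x))"
      unfolding f(2) by auto
    then show "X \<in> range (\<lambda>x. \<Inter>g\<in>E. \<phi> g -` cell P (\<phi> g x))"
      by blast
  next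
    fix X assume "X \<in> range (\<lambda>x. \<Inter>g\<in>E. \<phi> g -` cell P (\<phi> g x))"
    then obtain x where X: "X = (\<Inter>g\<in>E. \<phi> g -` cell P (\<phi> g x))"
      by blast
    define f where "f Q = (SOME B. B \<in> Q \<and> x \<in> B)" for Q
    have f: "f (?Q g) \<in> ?Q g \<and> x \<in> f (?Q g)" for g
      unfolding f_def
    proof (rule someI[of _ "\<phi> g -` cell P (\<phi> g x)"])
      show "\<phi> g -` cell P (\<phi> g x) \<in> ?Q g \<and> x \<in> \<phi> g -` cell P (\<phi> g x)"
        using cell_in[OF P] in_cell[OF P] by auto
    qed
    then have "f (?Q g) = \<phi> g -` cell P (\<phi> g x)" for g
      by (intro member) auto
    then have "X = \<Inter> (f ` ?Q ` E)"
      unfolding X by auto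
    moreover have "f \<in> (\<Pi> Q\<in>?Q ` E. Q)"
      using f by auto
    moreover have "x \<in> X"
      using in_cell[OF P] by (simp add: X)
    ultimately show "X \<in> common_refinement (?Q ` E)"
      unfolding common_refinement by blast
  qed
qed

lemma shannon_entropy_refined_partition:
  "partition_on UNIV P \<Longrightarrow> shannon_entropy M (refined_partition \<phi> E P) = block_ent (cell P) E"
  by (simp add: refined_partition_eq block_ent_def ent_def)

text \<open>The \<open>lim\<close> is the infimum over windows from
  \<open>block_ent_folner_limit\<close>; a bound on one well chosen window is all that remains to be
  found.\<close>

lemma partition_entropy_le:
  assumes P: "finite_measurable_partition M P" and F: "folner_seq G F"
    and W: "finite W" "W \<noteq> {}" "W \<subseteq> carrier G"
  shows "partition_entropy M \<phi> F P \<le> block_ent (cell P) W / real (card W)"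
proof -
  obtain L where L: "(\<lambda>n. block_ent (cell P) (F n) / real (card (F n))) \<longlonglongrightarrow> L"
    "L \<le> block_ent (cell P) W / real (card W)"
    using block_ent_folner_limit[OF finite_valued_cell[OF P] F] W by metis
  have "partition_on UNIV P"
    using P by (simp add: finite_measurable_partition_def space_UNIV)
  then have "partition_entropy M \<phi> F P = L"
    unfolding partition_entropy_def using L(1) by (simp add: shannon_entropy_refined_partition limI)
  with L(2) show ?thesis by simp
qed

end

section \<open>Coding by covers\<close>

context measure_preserving_action
begin

text \<open>
  A point of the orbit is encoded by a family \<open>T x\<close> of tiles lying in the window. The weights of
  all conceivable families sum to at most \<open>\<Prod> (1 + exp (- s * card (E \<iota>)))\<close>, so that the positions of
  the tiles cost nothing. The itinerary of \<open>f\<close> is read off the tiles and the itinerary of \<open>g\<close>, except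
  at the uncovered sites, which cost \<open>ln (card (range f))\<close> each.
\<close>

lemma block_ent_le_coding:
  fixes f :: "'x \<Rightarrow> 'b" and g :: "'x \<Rightarrow> 'c" and E :: "'i \<Rightarrow> 'g set" and s :: real
  assumes f: "finite_valued f" and g: "finite_valued g" and W: "finite W" "W \<subseteq> carrier G"
    and I: "finite I" and E: "\<And>\<iota>. \<iota> \<in> I \<Longrightarrow> E \<iota> \<subseteq> carrier G"
    and det: "\<And>\<iota> x y h. \<iota> \<in> I \<Longrightarrow> x \<in> B \<iota> \<Longrightarrow> y \<in> B \<iota> \<Longrightarrow> h \<in> E \<iota> \<Longrightarrow> g (\<phi> h x) = g (\<phi> h y) \<Longrightarrow> f (\<phi> h x) = f (\<phi> h y)"
    and T: "\<And>x. T x \<subseteq> W \<times> I"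
      "\<And>x a \<iota>. (a, \<iota>) \<in> T x \<Longrightarrow> \<phi> a x \<in> B \<iota> \<and> E \<iota> #> a \<subseteq> W"
    and b: "integrable M b" "\<And>x. s * (\<Sum>(a, \<iota>)\<in>T x. real (card (E \<iota>)))
        + ln (real (card (range f))) * real (card (W - (\<Union>(a, \<iota>)\<in>T x. E \<iota> #> a))) \<le> b x"
  shows "block_ent f W \<le> block_ent g W + expectation b + real (card W) * (\<Sum>\<iota>\<in>I. exp (- s * real (card (E \<iota>))))"
proof -
  define k where "k = card (range f)"
  have k: "0 < k"
    using f by (simp add: k_def finite_valued_def card_gt_0_iff)
  define f' where "f' = itinerary f W"
  define g' where "g' = itinerary g W"
  have fin: "finite_valued f'" "finite_valued g'"
    using finite_valued_itinerary f g W by (auto simp: f'_def g'_def)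
  define cov where "cov S = (\<Union>(a, \<iota>)\<in>S. E \<iota> #> a)" for S
  define compat where "compat S u v \<longleftrightarrow>
    (\<exists>x. u = f' x \<and> v = g' x \<and> (\<forall>(a, \<iota>)\<in>S. \<phi> a x \<in> B \<iota> \<and> E \<iota> #> a \<subseteq> W))" for S u v
  define cost where "cost S = s * (\<Sum>(a, \<iota>)\<in>S. real (card (E \<iota>))) + ln (real k) * real (card (W - cov S))" for S
  \<comment> \<open>The code may depend on the itineraries alone, whereas \<open>T x\<close> depends
    on \<open>x\<close>; hence the sum over all families \<open>S\<close>. The single term of
    \<open>T x\<close> bounds it from below.\<close>
  define w where "w u v = (\<Sum>S\<in>Pow (W \<times> I). if compat S u v then exp (- cost S) else 0)" for u v
  define Z where "Z = (\<Prod>p\<in>W \<times> I. exp (- s * real (card (E (snd p)))) + 1)"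
  have finWI: "finite (W \<times> I)"
    using W I by simp
  \<comment> \<open>Given \<open>S\<close> and \<open>v\<close>, \<open>det\<close> recovers
    \<open>u\<close> on \<open>cov S\<close>: a site there is \<open>h \<otimes> a\<close> with
    \<open>\<phi> a x\<close> and \<open>\<phi> a y\<close> in the same ball. Only the values on
    \<open>W - cov S\<close> are free.\<close>
  have compat_card: "card {u\<in>range f'. compat S u v} \<le> k ^ card (W - cov S)" if S: "S \<subseteq> W \<times> I" for S v
  proof -
    have "inj_on (\<lambda>u. restrict u (W - cov S)) {u\<in>range f'. compat S u v}"
    proof (rule inj_onI)
      fix u u' assume u: "u \<in> {u\<in>range f'. compat S u v}" and u': "u' \<in> {u\<in>range f'. compat S u v}"
        and eq: "restrict u (W - cov S) = restrict u' (W - cov S)"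
      obtain x where x: "u = f' x" "v = g' x" "\<forall>(a, \<iota>)\<in>S. \<phi> a x \<in> B \<iota> \<and> E \<iota> #> a \<subseteq> W"
        using u unfolding compat_def by blast
      obtain y where y: "u' = f' y" "v = g' y" "\<forall>(a, \<iota>)\<in>S. \<phi> a y \<in> B \<iota> \<and> E \<iota> #> a \<subseteq> W"
        using u' unfolding compat_def by blast
      have gW: "\<forall>c\<in>W. g (\<phi> c x) = g (\<phi> c y)"
        using x(2) y(2) by (simp add: g'_def itinerary_eq_iff)
      have "f (\<phi> c x) = f (\<phi> c y)" if c: "c \<in> W" for c
      proof (cases "c \<in> cov S")
        case True
        then obtain a \<iota> h where a: "(a, \<iota>) \<in> S" "h \<in> E \<iota>" "c = h \<otimes> a"
          unfolding cov_def r_coset_def by blast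
        have mem: "a \<in> carrier G" "h \<in> carrier G" "\<iota> \<in> I"
          using a S W E by auto
        have act_c: "\<phi> c z = \<phi> h (\<phi> a z)" for z
          unfolding a(3) by (rule act_mult[OF mem(2,1)])
        then have "g (\<phi> h (\<phi> a x)) = g (\<phi> h (\<phi> a y))"
          using bspec[OF gW c] by simp
        then have "f (\<phi> h (\<phi> a x)) = f (\<phi> h (\<phi> a y))"
          using x(3) y(3) a by (intro det[OF mem(3)]) auto
        then show ?thesis
          by (simp only: act_c)
      next
        case False
        then have "u c = u' c"
          using fun_cong[OF eq, of c] c by simp
        then show ?thesis
          using c by (simp add: x(1) y(1) f'_def itinerary_def)
      qed
      then show "u = u'"
        by (simp add: x(1) y(1) f'_def itinerary_eq_iff)
    qed
    moreover have "(\<lambda>u. restrict u (W - cov S)) ` {u\<in>range f'. compat S u v} \<subseteq> (W - cov S) \<rightarrow>\<^sub>E range f"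
      by (intro image_subsetI PiE_I) (auto simp: f'_def itinerary_def)
    moreover have "finite ((W - cov S) \<rightarrow>\<^sub>E range f)"
      using W f by (intro finite_PiE) (auto simp: finite_valued_def)
    ultimately have "card {u\<in>range f'. compat S u v} \<le> card ((W - cov S) \<rightarrow>\<^sub>E range f)"
      by (rule card_inj_on_le)
    then show ?thesis
      using W by (simp add: card_PiE k_def)
  qed
  \<comment> \<open>The \<open>ln k\<close> term of the cost cancels the number of compatible
    itineraries, so that the weights factor over the tiles.\<close>
  have exp_cost: "real (k ^ card (W - cov S)) * exp (- cost S) = (\<Prod>p\<in>S. exp (- s * real (card (E (snd p)))))"
    if S: "S \<subseteq> W \<times> I" for S
  proof -
    have "finite S"
      using S finWI finite_subset by blast
    have "real (k ^ card (W - cov S)) = exp (ln (real k) * real (card (W - cov S)))"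
      using k by (simp add: exp_of_nat2_mult)
    then have "real (k ^ card (W - cov S)) * exp (- cost S) = exp (- s * (\<Sum>(a, \<iota>)\<in>S. real (card (E \<iota>))))"
      by (simp add: cost_def flip: exp_add)
    also have "\<dots> = exp (\<Sum>p\<in>S. - s * real (card (E (snd p))))"
      by (simp add: sum_distrib_left split_def sum_negf)
    finally show ?thesis
      using \<open>finite S\<close> by (simp add: exp_sum)
  qed
  have "block_ent f W \<le> ent g' + expectation b + ln Z"
    unfolding block_ent_def f'_def[symmetric]
  proof (rule ent_le_conditional_code[OF fin, where w = w])
    show "0 \<le> w u v" for u v
      by (simp add: w_def sum_nonneg)
    have T_compat: "compat (T x) (f' x) (g' x)" for x
      unfolding compat_def using T(2) by blast
    have w_ge: "exp (- cost (T x)) \<le> w (f' x) (g' x)" for x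
    proof -
      have "exp (- cost (T x)) = (\<Sum>S\<in>{T x}. if compat S (f' x) (g' x) then exp (- cost S) else 0)"
        using T_compat by simp
      also have "\<dots> \<le> w (f' x) (g' x)"
        unfolding w_def by (rule sum_mono2) (use finWI T(1) in auto)
      finally show ?thesis .
    qed
    then show pos: "0 < w (f' x) (g' x)" for x
      using less_le_trans exp_gt_zero by blast
    show "- ln (w (f' x) (g' x)) \<le> b x" for x
    proof -
      have "- cost (T x) \<le> ln (w (f' x) (g' x))"
        using w_ge[of x] pos[of x] by (simp add: ln_ge_iff)
      then show ?thesis
        using b(2)[of x] by (simp add: cost_def cov_def k_def)
    qed
    show "integrable M b" by fact
    show "0 < Z"
      unfolding Z_def by (intro prod_pos) (simp add: add_pos_pos)
    fix v
    have finf': "finite (range f')"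
      using fin by (simp add: finite_valued_def)
    have "(\<Sum>u\<in>range f'. w u v) = (\<Sum>S\<in>Pow (W \<times> I). \<Sum>u\<in>range f'. if compat S u v then exp (- cost S) else 0)"
      unfolding w_def by (rule sum.swap)
    also have "\<dots> = (\<Sum>S\<in>Pow (W \<times> I). real (card {u\<in>range f'. compat S u v}) * exp (- cost S))"
      using finf' by (simp add: sum.If_cases Int_def)
    also have "\<dots> \<le> (\<Sum>S\<in>Pow (W \<times> I). real (k ^ card (W - cov S)) * exp (- cost S))"
      using compat_card by (intro sum_mono mult_right_mono) (auto simp del: of_nat_power)
    also have "\<dots> = (\<Sum>S\<in>Pow (W \<times> I). (\<Prod>p\<in>S. exp (- s * real (card (E (snd p))))) * (\<Prod>p\<in>W \<times> I - S. 1))"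
      using exp_cost by (intro sum.cong) auto
    \<comment> \<open>Expanding the product over all pairs of a site and a ball index gives one
      summand for each family \<open>S\<close>.\<close>
    also have "\<dots> = Z"
      unfolding Z_def by (rule prod_add[OF finWI, symmetric])
    finally show "(\<Sum>u\<in>range f'. w u v) \<le> Z" .
  qed
  moreover have "ln Z \<le> real (card W) * (\<Sum>\<iota>\<in>I. exp (- s * real (card (E \<iota>))))"
  proof -
    have ne: "exp r + 1 \<noteq> 0" for r :: real
      using exp_gt_zero[of r] by linarith
    have "ln Z = (\<Sum>p\<in>W \<times> I. ln (exp (- s * real (card (E (snd p)))) + 1))"
      unfolding Z_def by (rule ln_prod[OF finWI ne])
    also have "\<dots> \<le> (\<Sum>p\<in>W \<times> I. exp (- s * real (card (E (snd p)))))"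
    proof (rule sum_mono)
      fix p
      show "ln (exp (- s * real (card (E (snd p)))) + 1) \<le> exp (- s * real (card (E (snd p))))"
        using ln_add_one_self_le_self[of "exp (- s * real (card (E (snd p))))"] by (simp add: add.commute)
    qed
    also have "\<dots> = (\<Sum>a\<in>W. \<Sum>\<iota>\<in>I. exp (- s * real (card (E \<iota>))))"
      by (subst sum.cartesian_product) (simp add: split_def)
    finally show ?thesis by simp
  qed
  ultimately show ?thesis
    by (simp add: block_ent_def g'_def)
qed

end

text \<open>\<open>Q N m\<close> will say that \<open>F m\<close> is almost invariant under the tile
  shapes of the cover of level \<open>N\<close>. Iterating a threshold function \<open>nx\<close>
  produces levels at which every later scale is good for every earlier one.\<close>

lemma scales_by_iteration:
  fixes Q :: "nat \<Rightarrow> nat \<Rightarrow> bool"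
  assumes "\<And>N. \<forall>\<^sub>F m in sequentially. Q N m"
  shows "\<exists>N::nat \<Rightarrow> nat. \<forall>t t' m. t < t' \<longrightarrow> N t' \<le> m \<longrightarrow> Q (N t) m"
proof -
  have "\<exists>N'\<ge>N. \<forall>m\<ge>N'. Q N m" for N
    using assms[of N] unfolding eventually_sequentially by (meson le_trans max.cobounded1 max.cobounded2)
  then obtain nx where nx: "\<And>N. N \<le> nx N" "\<And>N m. nx N \<le> m \<Longrightarrow> Q N m"
    by metis
  define N where "N t = (nx ^^ t) 0" for t
  have N_Suc: "N (Suc t) = nx (N t)" for t
    by (simp add: N_def)
  then have "mono N"
    using nx(1) by (intro incseq_SucI) simp
  have "Q (N t) m" if "t < t'" "N t' \<le> m" for t t' m
  proof -
    have "N (Suc t) \<le> N t'"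
      using \<open>mono N\<close> that(1) by (intro monoD[of N]) auto
    then show ?thesis
      using nx(2) that(2) N_Suc by simp
  qed
  then show ?thesis
    by blast
qed

section \<open>Coding at several scales and the choice of the parameters\<close>

context measure_preserving_action
begin

text \<open>
  Only finitely many members of a countable cover are retained, at the price of missing a set of
  measure \<open>\<delta>\<close>.
\<close>

definition thrifty_cover ::
  "(nat \<Rightarrow> 'g set) \<Rightarrow> ('x \<Rightarrow> 'b) \<Rightarrow> ('x \<Rightarrow> 'c) \<Rightarrow> real \<Rightarrow> nat \<Rightarrow> real \<Rightarrow> nat set \<Rightarrow> (nat \<Rightarrow> nat) \<Rightarrow> (nat \<Rightarrow> 'x set) \<Rightarrow> bool"
  where "thrifty_cover F f g s N \<delta> J n B \<longleftrightarrow> finite J \<and>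
    (\<forall>i\<in>J. N \<le> n i \<and> B i \<in> events \<and>
      (\<forall>x\<in>B i. \<forall>y\<in>B i. \<forall>h\<in>F (n i). g (\<phi> h x) = g (\<phi> h y) \<longrightarrow> f (\<phi> h x) = f (\<phi> h y))) \<and>
    (\<Sum>i\<in>J. exp (- s * real (card (F (n i))))) \<le> \<delta> \<and> 1 - \<delta> \<le> prob (\<Union>i\<in>J. B i)"

text \<open>By invariance every site misses \<open>A\<close> with probability
  \<open>1 - prob A\<close>; linearity of the expectation does the rest.\<close>

lemma expectation_count_misses:
  assumes "finite W" "W \<subseteq> carrier G" "A \<in> events" "1 - \<delta> \<le> prob A"
  shows "integrable M (\<lambda>x. real (card {a\<in>W. \<phi> a x \<notin> A}))"
    and "expectation (\<lambda>x. real (card {a\<in>W. \<phi> a x \<notin> A})) \<le> \<delta> * real (card W)"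
proof -
  have eq: "real (card {a\<in>W. \<phi> a x \<notin> A}) = (\<Sum>a\<in>W. indicator (\<phi> a -` (- A)) x)" for x
    using assms(1) by (simp add: indicator_def sum.If_cases Int_def)
  have comp: "- A \<in> events"
    using assms(3) sets.compl_sets[of A M] by (simp add: space_UNIV Compl_eq_Diff_UNIV)
  have sets: "\<phi> a -` (- A) \<in> events" "prob (\<phi> a -` (- A)) \<le> \<delta>" if "a \<in> W" for a
  proof -
    have "prob (\<phi> a -` (- A)) = prob (- A)" "\<phi> a -` (- A) \<in> events"
      using prob_vimage_act[OF _ comp] that assms(2) by auto
    moreover have "prob (- A) = 1 - prob A"
      using prob_compl[OF assms(3)] by (simp add: space_UNIV Compl_eq_Diff_UNIV)
    ultimately show "\<phi> a -` (- A) \<in> events" "prob (\<phi> a -` (- A)) \<le> \<delta>"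
      using assms(4) by auto
  qed
  have int: "integrable M (\<lambda>x. indicator (\<phi> a -` (- A)) x :: real)" if "a \<in> W" for a
    using sets(1)[OF that] by (intro integrable_real_indicator) (auto simp: emeasure_eq_measure)
  show "integrable M (\<lambda>x. real (card {a\<in>W. \<phi> a x \<notin> A}))"
    unfolding eq by (rule Bochner_Integration.integrable_sum) (rule int)
  have "expectation (\<lambda>x. real (card {a\<in>W. \<phi> a x \<notin> A})) = (\<Sum>a\<in>W. prob (\<phi> a -` (- A)))"
    unfolding eq by (subst Bochner_Integration.integral_sum) (use int in \<open>auto simp: space_UNIV\<close>)
  also have "\<dots> \<le> (\<Sum>a\<in>W. \<delta>)"
    using sets(2) by (rule sum_mono)
  finally show "expectation (\<lambda>x. real (card {a\<in>W. \<phi> a x \<notin> A})) \<le> \<delta> * real (card W)"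
    by (simp add: mult.commute)
qed

text \<open>Origin of the terms: \<open>ent g\<close> pays for the coarse itinerary,
  \<open>s / (1 - d)\<close> for tiles whose sizes add up to at most
  \<open>card W / (1 - d)\<close>, and \<open>real r * \<delta>\<close> for the total weight of all
  balls. An uncovered site costs \<open>ln (card (range f))\<close>; one half of
  \<open>2 * real r * \<delta>\<close> counts centres whose \<open>E t #> a\<close> leaves
  \<open>W\<close>, the other half the misses of the finite covers, and
  \<open>real r * \<delta> / (1 - d)\<close> the boundaries of the tiles.\<close>

lemma block_ent_le_of_scales:
  fixes f :: "'x \<Rightarrow> 'b" and g :: "'x \<Rightarrow> 'c" and F :: "nat \<Rightarrow> 'g set"
    and J :: "nat \<Rightarrow> nat set" and n :: "nat \<Rightarrow> nat \<Rightarrow> nat" and B :: "nat \<Rightarrow> nat \<Rightarrow> 'x set"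
  defines "E t \<equiv> \<Union>i\<in>J t. F (n t i)"
  assumes F: "tempered_sequence G F C"
    and f: "finite_valued f" and g: "finite_valued g" and s: "0 \<le> s"
    and d: "0 < d" "d < 1" and \<delta>: "0 \<le> \<delta>" and W: "finite W" "W \<subseteq> carrier G"
    and cover: "\<And>t. t < r \<Longrightarrow> thrifty_cover F f g s (N t) \<delta> (J t) (n t) (B t)"
    and thin: "\<And>t t' m. t < t' \<Longrightarrow> t' < r \<Longrightarrow> N t' \<le> m \<Longrightarrow>
      real (card ((set_inv (E t) <#> F m) - F m)) \<le> \<delta> * real (card (F m))"
    and inner: "\<And>t. t < r \<Longrightarrow> real (card {a\<in>W. \<not> E t #> a \<subseteq> W}) \<le> \<delta> * real (card W)"
  shows "block_ent f W \<le> real (card W) * (ent g + s / (1 - d) + real r * \<delta>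
    + ln (real (card (range f))) * ((1 - 1 / (C / (1 - d) + 1 / d)) ^ r + 2 * real r * \<delta> + real r * \<delta> / (1 - d)))"
proof -
  interpret F: tempered_sequence G F C by fact
  define c where "c = 1 / (C / (1 - d) + 1 / d)"
  define O' where "O' t = (\<Union>i\<in>J t. B t i)" for t
  note cov = cover[unfolded thrifty_cover_def]
  have J: "finite (J t)" "\<And>i. i \<in> J t \<Longrightarrow> N t \<le> n t i" "\<And>i. i \<in> J t \<Longrightarrow> B t i \<in> events"
    and weight: "(\<Sum>i\<in>J t. exp (- s * real (card (F (n t i))))) \<le> \<delta>" and O'_prob: "1 - \<delta> \<le> prob (O' t)"
    if "t < r" for t
    using cov[OF that] unfolding O'_def by simp_all
  have det: "f (\<phi> h x) = f (\<phi> h y)"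
    if "t < r" "i \<in> J t" "x \<in> B t i" "y \<in> B t i" "h \<in> F (n t i)" "g (\<phi> h x) = g (\<phi> h y)" for t i x y h
    using cov[OF that(1)] that(2-) by blast
  have O'_events: "O' t \<in> events" if "t < r" for t
    unfolding O'_def using J[OF that] by (intro sets.finite_UN) auto
  have E: "finite (E t) \<and> E t \<subseteq> carrier G" if "t < r" for t
    using J(1)[OF that] F.finite_F F.F_carrier by (auto simp: E_def)
  define D where "D x t = {a\<in>W. \<phi> a x \<in> O' t \<and> E t #> a \<subseteq> W}" for x t
  \<comment> \<open>Picks a ball of scale \<open>t\<close> visited at site \<open>a\<close>; the
    level of the tile at \<open>a\<close>, hence its shape, is that of this ball.\<close>
  define idx where "idx x t a = (SOME i. i \<in> J t \<and> \<phi> a x \<in> B t i)" for x t a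
  have idx: "idx x t a \<in> J t" "\<phi> a x \<in> B t (idx x t a)" if "a \<in> D x t" for x t a
    using that someI_ex[of "\<lambda>i. i \<in> J t \<and> \<phi> a x \<in> B t i"] by (auto simp: D_def O'_def idx_def)
  define lev where "lev x t a = n t (idx x t a)" for x t a
  have lev_E: "F (lev x t a) \<subseteq> E t" if "a \<in> D x t" for x t a
    using idx(1)[OF that] by (auto simp: lev_def E_def)
  have lev_W: "F (lev x t a) #> a \<subseteq> W" if "a \<in> D x t" for x t a
  proof -
    have "F (lev x t a) #> a \<subseteq> E t #> a"
      using lev_E[OF that] by (auto simp: r_coset_def)
    then show ?thesis
      using that by (auto simp: D_def)
  qed
  define good where "good x S \<longleftrightarrow> S \<subseteq> Sigma {..<r} (D x) \<and>
      (1 - d) * (\<Sum>(t, a)\<in>S. real (card (F (lev x t a)))) \<le> real (card (\<Union>(t, a)\<in>S. F (lev x t a) #> a)) \<and>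
      real (card W) - real (card (\<Union>(t, a)\<in>S. F (lev x t a) #> a))
        \<le> (1 - c) ^ r * real (card W) + (\<Sum>t<r. real (card (W - D x t))) + real r * (\<delta> * real (card W) / (1 - d))"
    for x S
  have "\<exists>S. good x S" for x
    unfolding good_def c_def
  proof (rule F.multi_scale_cover[OF d \<delta> W, where E = E])
    fix t t' a assume "t < t'" "t' < r" "a \<in> D x t'"
    then show "real (card ((set_inv (E t) <#> F (lev x t' a)) - F (lev x t' a))) \<le> \<delta> * real (card (F (lev x t' a)))"
      using J(2)[of t' "idx x t' a"] idx(1) by (intro thin) (auto simp: lev_def)
  qed (use E lev_E lev_W in \<open>auto simp: D_def\<close>)
  then obtain S where good_S: "\<And>x. good x (S x)"
    by metis
  note S = good_S[unfolded good_def, THEN conjunct1] good_S[unfolded good_def, THEN conjunct2, THEN conjunct1]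
    good_S[unfolded good_def, THEN conjunct2, THEN conjunct2]
  define I where "I = Sigma {..<r} J"
  define E' where "E' = (\<lambda>(t, i). F (n t i))"
  define B' where "B' = (\<lambda>(t, i). B t i)"
  define code where "code x = (\<lambda>(t, a). (a, (t, idx x t a)))" for x
  define T where "T x = code x ` S x" for x
  have inj: "inj_on (code x) (S x)" for x
    by (auto simp: inj_on_def code_def)
  have sum_T: "(\<Sum>(a, \<iota>)\<in>T x. real (card (E' \<iota>))) = (\<Sum>(t, a)\<in>S x. real (card (F (lev x t a))))" for x
    unfolding T_def by (subst sum.reindex[OF inj]) (auto simp: code_def E'_def lev_def split_def intro!: sum.cong)
  have cov_T: "(\<Union>(a, \<iota>)\<in>T x. E' \<iota> #> a) = (\<Union>(t, a)\<in>S x. F (lev x t a) #> a)" for x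
    unfolding T_def code_def E'_def lev_def by auto
  define K where "K = ln (real (card (range f)))"
  have "0 < card (range f)"
    using f by (simp add: finite_valued_def card_gt_0_iff)
  then have K: "0 \<le> K"
    by (simp add: K_def)
  define w where "w = real (card W)"
  define misses where "misses x = (\<Sum>t<r. real (card {a\<in>W. \<phi> a x \<notin> O' t}))" for x
  \<comment> \<open>The families \<open>S x\<close> are arbitrary choices without measurability in
    \<open>x\<close>; what gets integrated is this bound, whose only variable part is
    \<open>misses\<close>.\<close>
  define b where "b x = s * (w / (1 - d)) + K * ((1 - c) ^ r * w + real r * (\<delta> * w) + real r * (\<delta> * w / (1 - d)))
      + K * misses x" for x
  have cost: "s * (\<Sum>(a, \<iota>)\<in>T x. real (card (E' \<iota>))) + K * real (card (W - (\<Union>(a, \<iota>)\<in>T x. E' \<iota> #> a))) \<le> b x" for x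
  proof -
    define U where "U = (\<Union>(t, a)\<in>S x. F (lev x t a) #> a)"
    have UW: "U \<subseteq> W"
      using S(1)[of x] lev_W by (fastforce simp: U_def)
    have "(1 - d) * (\<Sum>(t, a)\<in>S x. real (card (F (lev x t a)))) \<le> w"
      using S(2)[of x] card_mono[OF W(1) UW] by (simp add: U_def w_def)
    then have "(\<Sum>(t, a)\<in>S x. real (card (F (lev x t a)))) \<le> w / (1 - d)"
      using d by (simp add: field_simps)
    then have 1: "s * (\<Sum>(a, \<iota>)\<in>T x. real (card (E' \<iota>))) \<le> s * (w / (1 - d))"
      unfolding sum_T using s by (rule mult_left_mono)
    have "real (card (W - D x t)) \<le> \<delta> * w + real (card {a\<in>W. \<phi> a x \<notin> O' t})" if "t < r" for t
    proof -
      have "W - D x t = {a\<in>W. \<not> E t #> a \<subseteq> W} \<union> {a\<in>W. \<phi> a x \<notin> O' t}"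
        by (auto simp: D_def)
      then have "card (W - D x t) \<le> card {a\<in>W. \<not> E t #> a \<subseteq> W} + card {a\<in>W. \<phi> a x \<notin> O' t}"
        by (simp only: card_Un_le)
      then have "real (card (W - D x t)) \<le> real (card {a\<in>W. \<not> E t #> a \<subseteq> W}) + real (card {a\<in>W. \<phi> a x \<notin> O' t})"
        by linarith
      then show ?thesis
        using inner[OF that] by (simp add: w_def)
    qed
    then have "(\<Sum>t<r. real (card (W - D x t))) \<le> (\<Sum>t<r. \<delta> * w + real (card {a\<in>W. \<phi> a x \<notin> O' t}))"
      by (intro sum_mono) auto
    also have "\<dots> = real r * (\<delta> * w) + misses x"
      by (simp add: sum.distrib misses_def)
    finally have "real (card W) - real (card U) \<le> (1 - c) ^ r * w + real r * (\<delta> * w) + misses x + real r * (\<delta> * w / (1 - d))"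
      using S(3)[of x] by (simp add: U_def w_def)
    moreover have "real (card (W - U)) = real (card W) - real (card U)"
      using card_Diff_subset[OF finite_subset[OF UW W(1)] UW] card_mono[OF W(1) UW] by (simp add: of_nat_diff)
    ultimately have "K * real (card (W - U)) \<le> K * ((1 - c) ^ r * w + real r * (\<delta> * w) + misses x + real r * (\<delta> * w / (1 - d)))"
      using K by (intro mult_left_mono) auto
    with 1 show ?thesis
      unfolding cov_T U_def[symmetric] by (simp add: b_def distrib_left)
  qed
  have int: "integrable M misses"
    unfolding misses_def by (rule Bochner_Integration.integrable_sum)
      (use expectation_count_misses(1)[OF W O'_events O'_prob] in auto)
  have "expectation misses = (\<Sum>t<r. expectation (\<lambda>x. real (card {a\<in>W. \<phi> a x \<notin> O' t})))"
    unfolding misses_def by (rule Bochner_Integration.integral_sum)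
      (use expectation_count_misses(1)[OF W O'_events O'_prob] in auto)
  also have "\<dots> \<le> (\<Sum>t<r. \<delta> * w)"
    by (rule sum_mono) (use expectation_count_misses(2)[OF W O'_events O'_prob] in \<open>auto simp: w_def\<close>)
  finally have misses: "expectation misses \<le> real r * (\<delta> * w)"
    by simp
  have int_b: "integrable M b"
    unfolding b_def using int by simp
  have "expectation b = s * (w / (1 - d)) + K * ((1 - c) ^ r * w + real r * (\<delta> * w) + real r * (\<delta> * w / (1 - d)))
      + K * expectation misses"
    unfolding b_def using int by (subst Bochner_Integration.integral_add) (auto simp: prob_space)
  also have "\<dots> \<le> s * (w / (1 - d)) + K * ((1 - c) ^ r * w + real r * (\<delta> * w) + real r * (\<delta> * w / (1 - d)))
      + K * (real r * (\<delta> * w))"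
    using misses K by (intro add_left_mono mult_left_mono)
  finally have exp_b: "expectation b \<le> \<dots>" .
  have "block_ent f W \<le> block_ent g W + expectation b + real (card W) * (\<Sum>\<iota>\<in>I. exp (- s * real (card (E' \<iota>))))"
  proof (rule block_ent_le_coding[OF f g W, where B = B' and T = T])
    show "finite I"
      using J(1) by (auto simp: I_def)
    show "E' \<iota> \<subseteq> carrier G" for \<iota>
      using F.F_carrier by (auto simp: E'_def split: prod.splits)
    show "T x \<subseteq> W \<times> I" for x
      using S(1)[of x] idx(1)[of _ x] by (fastforce simp: T_def code_def I_def D_def)
    show "\<phi> a x \<in> B' \<iota> \<and> E' \<iota> #> a \<subseteq> W" if "(a, \<iota>) \<in> T x" for x a \<iota>
      using that S(1)[of x] idx(2)[of a x] lev_W[of a x] by (auto simp: T_def code_def B'_def E'_def lev_def)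
    show "f (\<phi> h x) = f (\<phi> h y)" if "\<iota> \<in> I" "x \<in> B' \<iota>" "y \<in> B' \<iota>" "h \<in> E' \<iota>" "g (\<phi> h x) = g (\<phi> h y)" for \<iota> x y h
    proof -
      obtain t i where \<iota>: "\<iota> = (t, i)" "t < r" "i \<in> J t"
        using \<open>\<iota> \<in> I\<close> by (auto simp: I_def)
      show ?thesis
        by (rule det[OF \<iota>(2,3)]) (use that \<iota>(1) in \<open>auto simp: B'_def E'_def\<close>)
    qed
    show "integrable M b" by (fact int_b)
    show "s * (\<Sum>(a, \<iota>)\<in>T x. real (card (E' \<iota>)))
        + ln (real (card (range f))) * real (card (W - (\<Union>(a, \<iota>)\<in>T x. E' \<iota> #> a))) \<le> b x" for x
      using cost[of x] by (simp add: K_def)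
  qed
  moreover have "block_ent g W \<le> w * ent g"
    using block_ent_le_card[OF g W] by (simp add: w_def)
  moreover have "real (card W) * (\<Sum>\<iota>\<in>I. exp (- s * real (card (E' \<iota>)))) \<le> w * (real r * \<delta>)"
  proof -
    have "(\<Sum>\<iota>\<in>I. exp (- s * real (card (E' \<iota>)))) = (\<Sum>t<r. \<Sum>i\<in>J t. exp (- s * real (card (F (n t i)))))"
      unfolding I_def E'_def by (subst sum.Sigma) (use J(1) in \<open>auto simp: split_def\<close>)
    also have "\<dots> \<le> (\<Sum>t<r. \<delta>)"
      by (rule sum_mono) (use weight in auto)
    finally show ?thesis
      by (intro mult_mono) (auto simp: w_def sum_nonneg)
  qed
  ultimately have "block_ent f W \<le> w * ent g + (s * (w / (1 - d)) + K * ((1 - c) ^ r * w + real r * (\<delta> * w) + real r * (\<delta> * w / (1 - d)))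
      + K * (real r * (\<delta> * w))) + w * (real r * \<delta>)"
    using exp_b by linarith
  also have "\<dots> = w * (ent g + s / (1 - d) + real r * \<delta> + K * ((1 - c) ^ r + 2 * real r * \<delta> + real r * \<delta> / (1 - d)))"
    by (simp add: algebra_simps add_divide_distrib)
  finally show ?thesis
    unfolding w_def K_def c_def .
qed

text \<open>Fixes the parameters. Covers are taken for all levels \<open>N\<close> at once,
  \<open>scales_by_iteration\<close> picks the levels from them, and the window \<open>F m\<close>
  is chosen last, large compared with the shapes of the \<open>r\<close> scales.\<close>

lemma block_ent_le_of_covers:
  fixes f :: "'x \<Rightarrow> 'b" and g :: "'x \<Rightarrow> 'c"
  assumes F: "tempered_sequence G F C" and folner: "folner_seq G F"
    and f: "finite_valued f" and g: "finite_valued g" and s: "0 \<le> s" and \<kappa>: "0 < \<kappa>"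
    and cover: "\<And>N \<delta>. 0 < \<delta> \<Longrightarrow> \<exists>J n B. thrifty_cover F f g s N \<delta> J n B"
  obtains W where "finite W" "W \<noteq> {}" "W \<subseteq> carrier G" "block_ent f W \<le> real (card W) * (ent g + s + \<kappa>)"
proof -
  interpret F: tempered_sequence G F C by fact
  define K where "K = ln (real (card (range f)))"
  have "0 < card (range f)"
    using f by (simp add: finite_valued_def card_gt_0_iff)
  then have K: "0 \<le> K"
    by (simp add: K_def)
  \<comment> \<open>One third each for the overlap of the tiles, the sites left after
    \<open>r\<close> scales, and all terms with \<open>\<delta>\<close>.\<close>
  define \<kappa>' where "\<kappa>' = \<kappa> / 3"
  have \<kappa>': "0 < \<kappa>'"
    using \<kappa> by (simp add: \<kappa>'_def)
  \<comment> \<open>The second bound gives \<open>s / (1 - d) \<le> s + \<kappa>'\<close>, the first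
    \<open>1 / (1 - d) \<le> 2\<close>.\<close>
  define d where "d = min (1 / 2) (\<kappa>' / (s + \<kappa>'))"
  have d: "0 < d" "d < 1" "d \<le> 1 / 2"
    using s \<kappa>' min.cobounded1[of "1 / 2" "\<kappa>' / (s + \<kappa>')"] by (auto simp: d_def simp del: min.bounded_iff)
  have sd: "s / (1 - d) \<le> s + \<kappa>'"
  proof -
    have "d * (s + \<kappa>') \<le> \<kappa>' / (s + \<kappa>') * (s + \<kappa>')"
      using s \<kappa>' by (intro mult_right_mono) (auto simp: d_def)
    then have "d * (s + \<kappa>') \<le> \<kappa>'"
      using s \<kappa>' by simp
    then have "s \<le> (s + \<kappa>') * (1 - d)"
      by (simp add: algebra_simps)
    then show ?thesis
      using d by (simp add: field_simps)
  qed
  define c where "c = 1 / (C / (1 - d) + 1 / d)"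
  have "0 \<le> C / (1 - d)" "1 \<le> 1 / d"
    using d F.C_nonneg by auto
  then have c: "0 < c" "c \<le> 1"
    by (auto simp: c_def field_simps)
  have "(\<lambda>r. K * (1 - c) ^ r) \<longlonglongrightarrow> K * 0"
    by (intro tendsto_intros LIMSEQ_realpow_zero) (use c in auto)
  then have "\<forall>\<^sub>F r in sequentially. K * (1 - c) ^ r < \<kappa>'"
    by (rule order_tendstoD(2)) (use \<kappa>' in simp)
  then obtain r where r: "K * (1 - c) ^ r < \<kappa>'"
    by (auto simp: eventually_sequentially)
  \<comment> \<open>As \<open>1 / (1 - d) \<le> 2\<close>, the terms with \<open>\<delta>\<close>
    are at most \<open>\<delta> * (real r + 4 * K * real r)\<close>; the extra \<open>1\<close>
    keeps the denominator positive for \<open>r = 0\<close>.\<close>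
  define \<delta> where "\<delta> = \<kappa>' / (1 + real r + 4 * K * real r)"
  have den: "0 < 1 + real r + 4 * K * real r"
    using K by (intro add_pos_nonneg) auto
  have \<delta>: "0 < \<delta>"
    using \<kappa>' den by (simp add: \<delta>_def)
  have "\<delta> * (real r + 4 * K * real r) \<le> \<delta> * (1 + real r + 4 * K * real r)"
    using \<delta> by (intro mult_left_mono) auto
  also have "\<dots> = \<kappa>'"
    using den by (simp add: \<delta>_def)
  finally have \<delta>_le: "\<delta> * (real r + 4 * K * real r) \<le> \<kappa>'" .
  obtain J n B where JnB: "\<And>N. thrifty_cover F f g s N \<delta> (J N) (n N) (B N)"
    using cover[OF \<delta>] by metis
  define E where "E N = (\<Union>i\<in>J N. F (n N i))" for N
  have E: "finite (E N)" "E N \<subseteq> carrier G" for N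
    using JnB[of N] F.finite_F F.F_carrier by (auto simp: E_def thrifty_cover_def)
  have outer: "\<forall>\<^sub>F m in sequentially. real (card ((set_inv (E N) <#> F m) - F m)) \<le> \<delta> * real (card (F m))" for N
    by (rule folner_outer[OF folner E \<delta>])
  from scales_by_iteration[of "\<lambda>N m. real (card ((set_inv (E N) <#> F m) - F m)) \<le> \<delta> * real (card (F m))", OF outer]
  obtain N :: "nat \<Rightarrow> nat" where N: "\<forall>t t' m. t < t' \<longrightarrow> N t' \<le> m \<longrightarrow>
      real (card ((set_inv (E (N t)) <#> F m) - F m)) \<le> \<delta> * real (card (F m))"
    by (elim exE)
  have "\<forall>\<^sub>F m in sequentially. \<forall>t\<in>{..<r}. real (card {a\<in>F m. \<not> E (N t) #> a \<subseteq> F m}) \<le> \<delta> * real (card (F m))"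
    by (intro eventually_ball_finite ballI folner_inner[OF folner E \<delta>]) simp
  then obtain m where m: "\<And>t. t < r \<Longrightarrow> real (card {a\<in>F m. \<not> E (N t) #> a \<subseteq> F m}) \<le> \<delta> * real (card (F m))"
    by (auto simp: eventually_sequentially)
  have "block_ent f (F m) \<le> real (card (F m)) * (ent g + s / (1 - d) + real r * \<delta>
    + ln (real (card (range f))) * ((1 - 1 / (C / (1 - d) + 1 / d)) ^ r + 2 * real r * \<delta> + real r * \<delta> / (1 - d)))"
    by (rule block_ent_le_of_scales[OF F f g s d(1,2) less_imp_le[OF \<delta>] F.finite_F F.F_carrier, where N = N,
          OF JnB N[rule_format, unfolded E_def] m[unfolded E_def]])
  also have "\<dots> \<le> real (card (F m)) * (ent g + s + \<kappa>)"
  proof (rule mult_left_mono)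
    have "real r * \<delta> / (1 - d) \<le> real r * \<delta> / (1 / 2)"
      using d \<delta> by (intro divide_left_mono) auto
    then have "2 * real r * \<delta> + real r * \<delta> / (1 - d) \<le> 2 * real r * \<delta> + real r * \<delta> / (1 / 2)"
      by (rule add_left_mono)
    also have "\<dots> = 4 * real r * \<delta>"
      by simp
    finally have "K * (2 * real r * \<delta> + real r * \<delta> / (1 - d)) \<le> K * (4 * real r * \<delta>)"
      using K by (rule mult_left_mono)
    then have "real r * \<delta> + K * ((1 - c) ^ r + 2 * real r * \<delta> + real r * \<delta> / (1 - d))
        \<le> K * (1 - c) ^ r + \<delta> * (real r + 4 * K * real r)"
      by (simp add: algebra_simps)
    then have "ent g + s / (1 - d) + real r * \<delta> + K * ((1 - c) ^ r + 2 * real r * \<delta> + real r * \<delta> / (1 - d))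
        \<le> ent g + s + \<kappa>"
      using sd r \<delta>_le by (simp add: \<kappa>'_def)
    then show "ent g + s / (1 - d) + real r * \<delta>
      + ln (real (card (range f))) * ((1 - 1 / (C / (1 - d) + 1 / d)) ^ r + 2 * real r * \<delta> + real r * \<delta> / (1 - d))
        \<le> ent g + s + \<kappa>"
      unfolding K_def c_def .
  qed simp
  finally show thesis
    by (rule that[OF F.finite_F F.nonempty_F F.F_carrier])
qed

end

section \<open>Approximation of partitions by compact sets\<close>

text \<open>\<open>K n\<close> consists of the points at distance at least
  \<open>1 / real (Suc n)\<close> from every point outside \<open>A\<close>; for open
  \<open>A\<close> these closed sets increase to \<open>A\<close>, and continuity from below
  applies.\<close>

lemma open_inner_closed_approx:
  fixes M :: "'x::metric_space measure"
  assumes "finite_measure M" "sets M = sets borel" "open A" "0 < e"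
  obtains K where "closed K" "K \<subseteq> A" "measure M (A - K) < e"
proof -
  interpret finite_measure M by fact
  define K where "K n = - (\<Union>y\<in>- A. ball y (1 / real (Suc n)))" for n
  have K: "closed (K n)" for n
    unfolding K_def by (intro closed_Compl open_UN) auto
  have KA: "K n \<subseteq> A" for n
    unfolding K_def by force
  have "incseq K"
  proof (rule incseq_SucI)
    fix n
    have "1 / real (Suc (Suc n)) \<le> 1 / real (Suc n)"
      by (simp add: field_simps)
    then show "K n \<subseteq> K (Suc n)"
      unfolding K_def by force
  qed
  moreover have "(\<Union>n. K n) = A"
  proof
    show "A \<subseteq> (\<Union>n. K n)"
    proof
      fix x assume "x \<in> A"
      then obtain r where r: "0 < r" "ball x r \<subseteq> A"
        using assms(3) open_contains_ball by blast
      then obtain n where "1 / real (Suc n) < r"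
        using nat_approx_posE by metis
      then have "x \<in> K n"
        using r(2) unfolding K_def by (auto simp: dist_commute subset_iff)
      then show "x \<in> (\<Union>n. K n)" by blast
    qed
  qed (use KA in auto)
  ultimately have "(\<lambda>n. measure M (K n)) \<longlonglongrightarrow> measure M A"
    using finite_Lim_measure_incseq[of K] K assms(2) by (simp add: image_subset_iff)
  then have "\<forall>\<^sub>F n in sequentially. measure M A - e < measure M (K n)"
    by (rule order_tendstoD(1)) (use assms(4) in simp)
  then obtain n where "measure M A - e < measure M (K n)"
    by (auto simp: eventually_sequentially)
  moreover have "measure M (A - K n) = measure M A - measure M (K n)"
    using assms K KA by (intro finite_measure_Diff) auto
  ultimately show thesis
    using that[OF K KA, of n] by simp
qed

text \<open>The library proves regularity for Polish spaces only.\<close>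

lemma borel_regular_metric:
  fixes M :: "'x::metric_space measure"
  assumes M: "finite_measure M" "sets M = sets borel" and A: "A \<in> sets M"
  shows "\<forall>e>0. \<exists>K U. closed K \<and> open U \<and> K \<subseteq> A \<and> A \<subseteq> U \<and> measure M (U - K) < e"
proof -
  interpret finite_measure M by fact
  have "A \<in> sigma_sets UNIV {S. open S}"
    using A M(2) by (simp add: sets_borel)
  then show ?thesis
  proof induction
    case (Basic A)
    show ?case
    proof (intro allI impI)
      fix e :: real assume "0 < e"
      have "open A"
        using Basic by simp
      obtain K where "closed K" "K \<subseteq> A" "measure M (A - K) < e"
        by (rule open_inner_closed_approx[OF M \<open>open A\<close> \<open>0 < e\<close>])
      then show "\<exists>K U. closed K \<and> open U \<and> K \<subseteq> A \<and> A \<subseteq> U \<and> measure M (U - K) < e"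
        using Basic by (intro exI[of _ K] exI[of _ A]) auto
    qed
  next
    case Empty
    show ?case
      by (intro allI impI exI[of _ "{}"]) auto
  next
    case (Compl A)
    show ?case
    proof (intro allI impI)
      fix e :: real assume "0 < e"
      from Compl.IH[rule_format, OF this]
      obtain K U where KU: "closed K" "open U" "K \<subseteq> A" "A \<subseteq> U" "measure M (U - K) < e"
        by (elim exE conjE)
      \<comment> \<open>Complements swap the inner and the outer set, which is why the induction
        carries both.\<close>
      have "(- K) - (- U) = U - K" by auto
      then show "\<exists>K U. closed K \<and> open U \<and> K \<subseteq> UNIV - A \<and> UNIV - A \<subseteq> U \<and> measure M (U - K) < e"
        using KU(3,4,5)
        by (intro exI[of _ "- U"] exI[of _ "- K"] conjI closed_Compl open_Compl KU(1,2)) auto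
    qed
  next
    case (Union a)
    show ?case
    proof (intro allI impI)
      fix e :: real assume e: "0 < e"
      have "\<exists>K U. closed K \<and> open U \<and> K \<subseteq> a i \<and> a i \<subseteq> U \<and> measure M (U - K) < e / 2 * (1 / 2) ^ Suc i" for i
        by (rule Union.IH[rule_format]) (use e in simp)
      then obtain K U where KU: "\<And>i. closed (K i)" "\<And>i. open (U i)" "\<And>i. K i \<subseteq> a i" "\<And>i. a i \<subseteq> U i"
        "\<And>i. measure M (U i - K i) < e / 2 * (1 / 2) ^ Suc i"
        by metis
      have sets: "K i \<in> sets M" "U i \<in> sets M" for i
        using KU M(2) by auto
      have sums: "(\<lambda>i. e / 2 * (1 / 2) ^ Suc i) sums (e / 2 * 1)"
        by (intro sums_mult power_half_series)
      have le: "measure M (U i - K i) \<le> e / 2 * (1 / 2) ^ Suc i" for i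
        using KU(5)[of i] by simp
      have summ: "summable (\<lambda>i. measure M (U i - K i))"
        by (rule summable_comparison_test'[OF sums_summable[OF sums], of 0]) (use le in auto)
      have "measure M (\<Union>i. U i - K i) \<le> (\<Sum>i. measure M (U i - K i))"
        by (rule finite_measure_subadditive_countably[OF _ summ]) (use sets in auto)
      also have "\<dots> \<le> (\<Sum>i. e / 2 * (1 / 2) ^ Suc i)"
        by (rule suminf_le[OF le summ sums_summable[OF sums]])
      also have "\<dots> = e / 2"
        using sums_unique[OF sums] by simp
      finally have 1: "measure M (\<Union>i. U i - K i) \<le> e / 2" .
      \<comment> \<open>An infinite union of closed sets need not be closed. Passing to a finite
        part loses less than \<open>e / 2\<close>; the other half is the sum of the errors of the
        \<open>a i\<close>.\<close>
      define L where "L n = (\<Union>i<n. K i)" for n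
      have L: "closed (L n)" "L n \<in> sets M" for n
        using KU(1) sets by (auto simp: L_def)
      have "incseq L"
        by (rule incseq_SucI) (auto simp: L_def less_Suc_eq)
      moreover have UL: "(\<Union>n. L n) = (\<Union>i. K i)"
        by (auto simp: L_def)
      ultimately have "(\<lambda>n. measure M (L n)) \<longlonglongrightarrow> measure M (\<Union>i. K i)"
        using finite_Lim_measure_incseq[of L] L by (simp add: image_subset_iff)
      then have "\<forall>\<^sub>F n in sequentially. measure M (\<Union>i. K i) - e / 2 < measure M (L n)"
        by (rule order_tendstoD(1)) (use e in simp)
      then obtain n where n: "measure M (\<Union>i. K i) - e / 2 < measure M (L n)"
        by (auto simp: eventually_sequentially)
      have "measure M ((\<Union>i. K i) - L n) = measure M (\<Union>i. K i) - measure M (L n)"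
        by (rule finite_measure_Diff) (use sets L UL in auto)
      then have 2: "measure M ((\<Union>i. K i) - L n) < e / 2"
        using n by simp
      have "measure M ((\<Union>i. U i) - L n) \<le> measure M ((\<Union>i. U i - K i) \<union> ((\<Union>i. K i) - L n))"
        by (rule finite_measure_mono) (use sets L in auto)
      also have "\<dots> \<le> measure M (\<Union>i. U i - K i) + measure M ((\<Union>i. K i) - L n)"
        by (rule measure_Un_le) (use sets L in auto)
      finally have "measure M ((\<Union>i. U i) - L n) < e"
        using 1 2 by simp
      moreover have "L n \<subseteq> (\<Union>i. a i)"
        using KU(3) by (auto simp: L_def)
      moreover have "open (\<Union>i. U i)" "(\<Union>i. a i) \<subseteq> (\<Union>i. U i)"
        using KU(2) UN_mono[of UNIV UNIV a U] KU(4) by auto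
      ultimately show "\<exists>K U. closed K \<and> open U \<and> K \<subseteq> (\<Union>i. a i) \<and> (\<Union>i. a i) \<subseteq> U \<and> measure M (U - K) < e"
        using L(1) by (intro exI[of _ "L n"] exI[of _ "\<Union>i. U i"] conjI)
    qed
  qed
qed

corollary closed_inner_regular:
  fixes M :: "'x::metric_space measure"
  assumes M: "finite_measure M" "sets M = sets borel" and A: "A \<in> sets M" and "0 < e"
  obtains K where "closed K" "K \<subseteq> A" "measure M (A - K) < e"
proof -
  interpret finite_measure M by fact
  obtain K U where KU: "closed K" "open U" "K \<subseteq> A" "A \<subseteq> U" "measure M (U - K) < e"
    using borel_regular_metric[OF M A, rule_format, OF assms(4)] by (elim exE conjE)
  have "measure M (A - K) \<le> measure M (U - K)"
    by (rule finite_measure_mono) (use KU M in auto)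
  then show thesis
    using that KU by simp
qed

text \<open>For positive \<open>p\<close>,
  \<open>- ln p = 2 * ln (1 / sqrt p) \<le> 2 / sqrt p\<close>. Unlike \<open>p * - ln p\<close>,
  the bound is monotone in \<open>p\<close>, so an upper estimate of a probability can be
  inserted.\<close>

lemma neg_mult_ln_le_sqrt:
  fixes p :: real
  assumes "0 \<le> p"
  shows "p * - ln p \<le> 2 * sqrt p"
proof (cases "p = 0")
  case False
  then have p: "0 < p" using assms by simp
  have "- ln p = 2 * ln (1 / sqrt p)"
    using p by (simp add: ln_div ln_sqrt)
  also have "\<dots> \<le> 2 * (1 / sqrt p)"
    using p ln_le_minus_one[of "1 / sqrt p"] by simp
  finally have "p * - ln p \<le> p * (2 * (1 / sqrt p))"
    using p by (intro mult_left_mono) auto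
  also have "\<dots> = 2 * (p / sqrt p)"
    by simp
  also have "p / sqrt p = sqrt p"
    using p by (intro real_div_sqrt) simp
  finally show ?thesis .
qed simp

text \<open>For one pair, \<open>e\<close> is a Lebesgue number of \<open>K i\<close> for the cover
  by the single open set \<open>- K j\<close>; finitely many pairs are combined as a statement about
  all small \<open>e\<close>.\<close>

lemma compact_family_separated:
  fixes K :: "'i \<Rightarrow> 'x::metric_space set"
  assumes "finite I" "\<And>i. i \<in> I \<Longrightarrow> compact (K i)"
    and disj: "\<And>i j. i \<in> I \<Longrightarrow> j \<in> I \<Longrightarrow> i \<noteq> j \<Longrightarrow> K i \<inter> K j = {}"
  obtains e where "0 < e" "\<And>i j x y. i \<in> I \<Longrightarrow> j \<in> I \<Longrightarrow> i \<noteq> j \<Longrightarrow> x \<in> K i \<Longrightarrow> y \<in> K j \<Longrightarrow> e \<le> dist x y"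
proof -
  have "\<forall>\<^sub>F e in at_right 0. \<forall>i\<in>I. \<forall>j\<in>I. i \<noteq> j \<longrightarrow> (\<forall>x\<in>K i. \<forall>y\<in>K j. e \<le> dist x y)"
  proof (intro eventually_ball_finite assms(1) ballI)
    fix i j assume ij: "i \<in> I" "j \<in> I"
    show "\<forall>\<^sub>F e in at_right 0. i \<noteq> j \<longrightarrow> (\<forall>x\<in>K i. \<forall>y\<in>K j. e \<le> dist x y)"
    proof (cases "i = j")
      case False
      then have "K i \<subseteq> \<Union>{- K j}"
        using disj ij by auto
      then obtain e where e: "0 < e" "\<And>x. x \<in> K i \<Longrightarrow> \<exists>V\<in>{- K j}. ball x e \<subseteq> V"
        by (rule Heine_Borel_lemma[rotated]) (use assms(2) ij compact_imp_closed in auto)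
      have *: "e \<le> dist x y" if "x \<in> K i" "y \<in> K j" for x y
      proof -
        have "y \<notin> ball x e"
          using e(2)[OF that(1)] that(2) by blast
        then show ?thesis by simp
      qed
      have "\<forall>\<^sub>F e' in at_right 0. e' < e"
        using e(1) by (auto simp: eventually_at_right_field)
      then show ?thesis
        by eventually_elim (use * in force)
    qed simp
  qed
  then have "\<forall>\<^sub>F e in at_right 0. 0 < e \<and> (\<forall>i\<in>I. \<forall>j\<in>I. i \<noteq> j \<longrightarrow> (\<forall>x\<in>K i. \<forall>y\<in>K j. e \<le> dist x y))"
    using eventually_at_right_less[of 0] by eventually_elim auto
  then obtain e where "0 < e" "\<forall>i\<in>I. \<forall>j\<in>I. i \<noteq> j \<longrightarrow> (\<forall>x\<in>K i. \<forall>y\<in>K j. e \<le> dist x y)"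
    using eventually_happens'[of "at_right (0::real)"] by force
  then show thesis
    using that by blast
qed

section \<open>Entropy of the coarse partition\<close>

context measure_preserving_action
begin

text \<open>The empty set is not a cell of a partition, so it can serve as the common label of all
  points in the shrunken cells.\<close>

definition coarse_cell :: "('x set \<Rightarrow> 'x set) \<Rightarrow> 'x set set \<Rightarrow> 'x \<Rightarrow> 'x set" where
  "coarse_cell K P x = (if x \<in> K (cell P x) then {} else cell P x)"

lemma
  assumes P: "finite_measurable_partition M P"
    and K: "\<And>A. A \<in> P \<Longrightarrow> K A \<subseteq> A" "\<And>A. A \<in> P \<Longrightarrow> K A \<in> events"
  shows finite_valued_coarse_cell: "finite_valued (coarse_cell K P)"
    and coarse_cell_fibre: "A \<in> P \<Longrightarrow> coarse_cell K P -` {A} = A - K A"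
    and range_coarse_cell: "range (coarse_cell K P) \<subseteq> insert {} P"
proof -
  have P': "finite P" "P \<subseteq> events" "partition_on UNIV P"
    using P by (auto simp: finite_measurable_partition_def space_UNIV)
  have "{} \<notin> P"
    using partition_onD3[OF P'(3)] .
  note cell = cell_eq[OF P'(3)] cell_in[OF P'(3)] in_cell[OF P'(3)]
  show A: "coarse_cell K P -` {A} = A - K A" if "A \<in> P" for A
  proof (rule Set.set_eqI)
    fix x
    show "x \<in> coarse_cell K P -` {A} \<longleftrightarrow> x \<in> A - K A"
      using that cell(1)[OF that, of x] cell(3)[of x] \<open>{} \<notin> P\<close>
      by (cases "x \<in> A") (auto simp: coarse_cell_def)
  qed
  have empty: "coarse_cell K P -` {{}} = (\<Union>A\<in>P. K A)"
  proof (rule Set.set_eqI, rule iffI)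
    fix x assume "x \<in> (\<Union>A\<in>P. K A)"
    then obtain A where "A \<in> P" "x \<in> K A" by blast
    then show "x \<in> coarse_cell K P -` {{}}"
      using K(1) cell(1)[of A x] by (auto simp: coarse_cell_def)
  next
    fix x assume "x \<in> coarse_cell K P -` {{}}"
    then show "x \<in> (\<Union>A\<in>P. K A)"
      using cell(2,3)[of x] by (cases "x \<in> K (cell P x)") (auto simp: coarse_cell_def)
  qed
  show range: "range (coarse_cell K P) \<subseteq> insert {} P"
    using cell(2) by (auto simp: coarse_cell_def)
  have UK: "(\<Union>A\<in>P. K A) \<in> events"
    by (rule sets.finite_UN) (use P' K(2) in auto)
  have "coarse_cell K P -` {u} \<in> events" for u
  proof (cases "u \<in> insert {} P")
    case True
    then show ?thesis
      using A empty P' K(2) UK by auto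
  next
    case False
    then have "coarse_cell K P -` {u} = {}"
      using range by blast
    then show ?thesis by simp
  qed
  then show "finite_valued (coarse_cell K P)"
    using finite_subset[OF range] P'(1) by (simp add: finite_valued_def)
qed

text \<open>Each remainder \<open>A - K A\<close> contributes at most \<open>2 * sqrt p\<close>. For
  the large fibre over \<open>{}\<close>, of probability \<open>q\<close>, the bound
  \<open>q * - ln q \<le> 1 - q\<close> leaves the total mass of the remainders, at most
  \<open>card P * p\<close>, and \<open>p \<le> sqrt p\<close>.\<close>

lemma ent_coarse_cell_le:
  assumes P: "finite_measurable_partition M P"
    and K: "\<And>A. A \<in> P \<Longrightarrow> K A \<subseteq> A" "\<And>A. A \<in> P \<Longrightarrow> K A \<in> events"
      "\<And>A. A \<in> P \<Longrightarrow> prob (A - K A) \<le> p" and p: "p \<le> 1"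
  shows "ent (coarse_cell K P) \<le> real (card P) * (3 * sqrt p)"
proof -
  let ?g = "coarse_cell K P"
  let ?\<eta> = "\<lambda>u. prob (?g -` {u}) * - ln (prob (?g -` {u}))"
  have P': "finite P" "P \<subseteq> events" "partition_on UNIV P"
    using P by (auto simp: finite_measurable_partition_def space_UNIV)
  have "{} \<notin> P"
    using partition_onD3[OF P'(3)] .
  have g: "finite_valued ?g" "\<And>A. A \<in> P \<Longrightarrow> ?g -` {A} = A - K A" "range ?g \<subseteq> insert {} P"
    using finite_valued_coarse_cell[OF P] coarse_cell_fibre[OF P] range_coarse_cell[OF P] K(1,2) by simp_all
  have nonneg: "0 \<le> ?\<eta> u" for u
  proof (cases "prob (?g -` {u}) = 0")
    case False
    then have "ln (prob (?g -` {u})) \<le> 0"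
      by (simp add: zero_less_measure_iff)
    then show ?thesis
      by (intro mult_nonneg_nonneg) auto
  qed simp
  have p0: "0 \<le> p" if "A \<in> P" for A
    using K(3)[OF that] measure_nonneg order_trans by blast
  have "ent ?g \<le> (\<Sum>u\<in>insert {} P. ?\<eta> u)"
    unfolding ent_eq_sum by (rule sum_mono2) (use P' g(3) nonneg in auto)
  also have "\<dots> = ?\<eta> {} + (\<Sum>A\<in>P. ?\<eta> A)"
    using P' \<open>{} \<notin> P\<close> by simp
  also have "(\<Sum>A\<in>P. ?\<eta> A) \<le> (\<Sum>A\<in>P. 2 * sqrt p)"
  proof (rule sum_mono)
    fix A assume A: "A \<in> P"
    have "?\<eta> A \<le> 2 * sqrt (prob (?g -` {A}))"
      by (rule neg_mult_ln_le_sqrt) simp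
    also have "\<dots> \<le> 2 * sqrt p"
      using K(3)[OF A] g(2)[OF A] by simp
    finally show "?\<eta> A \<le> 2 * sqrt p" .
  qed
  also have "?\<eta> {} \<le> real (card P) * sqrt p"
  proof -
    let ?q = "prob (?g -` {{}})"
    have "?\<eta> {} \<le> 1 - ?q"
    proof (cases "?q = 0")
      case False
      then have q: "0 < ?q"
        by (simp add: zero_less_measure_iff)
      then have "- ln ?q \<le> 1 / ?q - 1"
        using ln_le_minus_one[of "1 / ?q"] by (simp add: ln_div)
      then have "?q * - ln ?q \<le> ?q * (1 / ?q - 1)"
        by (rule mult_left_mono) simp
      also have "\<dots> = 1 - ?q"
        using q by (simp add: field_simps)
      finally show ?thesis .
    qed simp
    also have "1 - ?q = prob (UNIV - ?g -` {{}})"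
      using prob_compl[of "?g -` {{}}"] g(1) by (simp add: finite_valued_def space_UNIV)
    also have "UNIV - ?g -` {{}} = (\<Union>A\<in>P. ?g -` {A})"
    proof -
      have "?g x \<in> insert {} P" for x
        using g(3) by blast
      then have "?g x \<noteq> {} \<longleftrightarrow> ?g x \<in> P" for x
        using \<open>{} \<notin> P\<close> by (metis insertE)
      then show ?thesis
        by (intro Set.set_eqI) simp
    qed
    also have "prob (\<Union>A\<in>P. ?g -` {A}) \<le> (\<Sum>A\<in>P. prob (?g -` {A}))"
      using P'(1) g(1) by (intro finite_measure_subadditive_finite) (auto simp: finite_valued_def)
    also have "\<dots> \<le> (\<Sum>A\<in>P. sqrt p)"
    proof (rule sum_mono)
      fix A assume A: "A \<in> P"
      have "prob (?g -` {A}) \<le> p"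
        using K(3)[OF A] g(2)[OF A] by simp
      also have "p \<le> sqrt p"
        using p p0[OF A] by (simp add: real_le_rsqrt power2_eq_square mult_left_le)
      finally show "prob (?g -` {A}) \<le> sqrt p" .
    qed
    finally show ?thesis by simp
  qed
  finally show ?thesis
    by (simp add: algebra_simps)
qed

end

section \<open>The Bowen entropy of a set of full measure\<close>

lemma infsum_ennreal_finite_sum_le:
  fixes f :: "'i \<Rightarrow> ennreal"
  assumes "finite J" "J \<subseteq> I"
  shows "sum f J \<le> infsum f I"
  by (subst nonneg_infsum_complete) (use assms in \<open>auto intro: SUP_upper\<close>)

text \<open>Above the critical value \<open>bowen_M\<close> vanishes, and as a supremum over
  \<open>\<epsilon>\<close> and \<open>N\<close> it forces every \<open>bowen_M_N\<close> to vanish,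
  so arbitrarily cheap covers exist. The bound is recorded for finite subfamilies, where the sum is
  an ordinary real one.\<close>

lemma bowen_entropy_cover:
  assumes card: "filterlim (\<lambda>n. card (F n)) at_top sequentially"
    and s: "0 \<le> s" "bowen_entropy \<phi> F Z < ennreal s" and pos: "0 < \<epsilon>" "0 < \<eta>"
  shows "\<exists>(I::nat set) n x. (\<forall>i\<in>I. N \<le> n i) \<and> Z \<subseteq> (\<Union>i\<in>I. bowen_ball \<phi> (F (n i)) (x i) \<epsilon>) \<and>
    (\<forall>J. finite J \<longrightarrow> J \<subseteq> I \<longrightarrow> (\<Sum>i\<in>J. exp (- s * real (card (F (n i))))) \<le> \<eta>)"
proof -
  have "is_critical_value (bowen_M \<phi> F Z) (bowen_entropy \<phi> F Z)"
    unfolding bowen_entropy_def by (rule theI'[OF ex1_critical_value[OF card]])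
  then have "bowen_M \<phi> F Z s = 0"
    using s by (simp add: is_critical_value_def)
  moreover have "bowen_M_eps \<phi> F Z \<epsilon> s \<le> bowen_M \<phi> F Z s"
    unfolding bowen_M_eq_SUP by (rule SUP_upper) (use pos in simp)
  moreover have "bowen_M_N \<phi> F Z N \<epsilon> s \<le> bowen_M_eps \<phi> F Z \<epsilon> s"
    by (rule incseq_le[OF _ bowen_M_eps_LIMSEQ]) (auto intro!: incseq_SucI bowen_M_N_mono)
  ultimately have "bowen_M_N \<phi> F Z N \<epsilon> s < ennreal \<eta>"
    using pos by simp
  then obtain I :: "nat set" and n x where I: "\<forall>i\<in>I. n i \<ge> N"
    "Z \<subseteq> (\<Union>i\<in>I. bowen_ball \<phi> (F (n i)) (x i) \<epsilon>)"
    and less: "(\<Sum>\<^sub>\<infinity>i\<in>I. ennreal (exp (- s * real (card (F (n i)))))) < ennreal \<eta>"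
    unfolding bowen_M_N_def Inf_less_iff by blast
  have "(\<Sum>i\<in>J. exp (- s * real (card (F (n i))))) \<le> \<eta>" if "finite J" "J \<subseteq> I" for J
  proof -
    have "ennreal (\<Sum>i\<in>J. exp (- s * real (card (F (n i))))) = (\<Sum>i\<in>J. ennreal (exp (- s * real (card (F (n i))))))"
      by simp
    also have "\<dots> < ennreal \<eta>"
      using infsum_ennreal_finite_sum_le[OF that] less by (rule le_less_trans)
    finally show ?thesis
      using pos by (simp add: ennreal_less_iff sum_nonneg)
  qed
  with I show ?thesis
    by (intro exI[of _ I] exI[of _ n] exI[of _ x]) simp
qed

lemma open_bowen_ball:
  assumes "finite E" "\<And>g. g \<in> E \<Longrightarrow> continuous_on UNIV (\<phi> g)"
  shows "open (bowen_ball \<phi> E x \<epsilon>)"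
proof -
  have "bowen_ball \<phi> E x \<epsilon> = (\<Inter>g\<in>E. \<phi> g -` ball (\<phi> g x) \<epsilon>)"
    by (auto simp: bowen_ball_def)
  moreover have "open (\<phi> g -` ball (\<phi> g x) \<epsilon>)" if "g \<in> E" for g
    using assms(2)[OF that] by (intro open_vimage) auto
  ultimately show ?thesis
    using assms(1) by auto
qed

lemma (in finite_measure) countable_union_finite_part:
  fixes I :: "nat set"
  assumes "\<And>i. i \<in> I \<Longrightarrow> B i \<in> sets M" "0 < e"
  obtains J where "finite J" "J \<subseteq> I" "measure M (\<Union>i\<in>I. B i) - e \<le> measure M (\<Union>i\<in>J. B i)"
proof -
  define U where "U k = (\<Union>i\<in>{i\<in>I. i < k}. B i)" for k
  have "U k \<in> sets M" for k
    unfolding U_def using assms(1) by (intro sets.finite_UN) auto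
  moreover have "incseq U"
    by (rule incseq_SucI) (auto simp: U_def)
  ultimately have "(\<lambda>k. measure M (U k)) \<longlonglongrightarrow> measure M (\<Union>k. U k)"
    by (intro finite_Lim_measure_incseq) auto
  moreover have "(\<Union>k. U k) = (\<Union>i\<in>I. B i)"
    by (auto simp: U_def)
  ultimately have "\<forall>\<^sub>F k in sequentially. measure M (\<Union>i\<in>I. B i) - e < measure M (U k)"
    using assms(2) by (intro order_tendstoD(1)[of _ "measure M (\<Union>i\<in>I. B i)"]) auto
  then obtain k where "measure M (\<Union>i\<in>I. B i) - e < measure M (U k)"
    by (auto simp: eventually_sequentially)
  then show thesis
    by (intro that[of "{i\<in>I. i < k}"]) (auto simp: U_def)
qed

lemma partition_entropy_le_bowen:
  fixes M :: "'x::metric_space measure" and \<phi> :: "'g \<Rightarrow> 'x \<Rightarrow> 'x"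
  assumes act: "measure_preserving_action M G \<phi>" and borel: "sets M = sets borel"
    and compact: "compact (UNIV :: 'x set)" and cont: "\<And>g. g \<in> carrier G \<Longrightarrow> continuous_on UNIV (\<phi> g)"
    and F: "tempered_sequence G F C" "folner_seq G F"
    and card: "filterlim (\<lambda>n. card (F n)) at_top sequentially"
    and Y: "Y \<in> sets (completion M)" "emeasure (completion M) Y = 1"
    and P: "finite_measurable_partition M P"
    and s: "0 \<le> s" "bowen_entropy \<phi> F Y < ennreal s"
  shows "partition_entropy M \<phi> F P \<le> s"
proof (rule field_le_epsilon)
  fix \<kappa> :: real assume \<kappa>: "0 < \<kappa>"
  interpret measure_preserving_action M G \<phi> by fact
  interpret F: tempered_sequence G F C by fact
  have P': "finite P" "P \<subseteq> events" "partition_on UNIV P"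
    using P by (auto simp: finite_measurable_partition_def space_UNIV)
  \<comment> \<open>Makes the entropy bound \<open>card P * (3 * sqrt p)\<close> of the coarse
    partition at most \<open>\<kappa> / 2\<close>; the other half of \<open>\<kappa>\<close> is left
    for the coding.\<close>
  define p where "p = min 1 ((\<kappa> / 2 / (3 * real (card P) + 1))\<^sup>2)"
  have p: "0 < p" "p \<le> 1"
    using \<kappa> by (auto simp: p_def add_nonneg_pos)
  have "sqrt p \<le> \<kappa> / 2 / (3 * real (card P) + 1)"
    using \<kappa> by (intro real_le_lsqrt) (auto simp: p_def)
  then have "sqrt p * (3 * real (card P) + 1) \<le> \<kappa> / 2"
    by (subst (asm) pos_le_divide_eq) auto
  moreover have "sqrt p * (3 * real (card P) + 1) = real (card P) * (3 * sqrt p) + sqrt p"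
    by (simp add: algebra_simps)
  ultimately have small: "real (card P) * (3 * sqrt p) \<le> \<kappa> / 2"
    using real_sqrt_gt_zero[OF p(1)] by linarith
  have fin: "finite_measure M"
    by unfold_locales
  have "\<exists>K. closed K \<and> K \<subseteq> A \<and> prob (A - K) < p" if "A \<in> P" for A
  proof -
    have "A \<in> events"
      using that P' by blast
    show ?thesis
      by (rule closed_inner_regular[OF fin borel \<open>A \<in> events\<close> p(1)]) blast
  qed
  then obtain K where K: "\<And>A. A \<in> P \<Longrightarrow> closed (K A)" "\<And>A. A \<in> P \<Longrightarrow> K A \<subseteq> A" "\<And>A. A \<in> P \<Longrightarrow> prob (A - K A) < p"
    by metis
  have K_events: "K A \<in> events" if "A \<in> P" for A
    using K(1)[OF that] borel by auto
  have disj: "A \<inter> B = {}" if "A \<in> P" "B \<in> P" "A \<noteq> B" for A B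
    using disjointD[OF partition_onD2[OF P'(3)]] that by blast
  obtain e where e: "0 < e"
    "\<And>A B x y. A \<in> P \<Longrightarrow> B \<in> P \<Longrightarrow> A \<noteq> B \<Longrightarrow> x \<in> K A \<Longrightarrow> y \<in> K B \<Longrightarrow> e \<le> dist x y"
  proof (rule compact_family_separated[OF P'(1), of K])
    show "compact (K A)" if "A \<in> P" for A
      using compact_Int_closed[OF compact K(1)[OF that]] by simp
    show "K A \<inter> K B = {}" if "A \<in> P" "B \<in> P" "A \<noteq> B" for A B
      using K(2) disj that by blast
  qed blast
  let ?f = "cell P" and ?g = "coarse_cell K P"
  note cell = cell_in[OF P'(3)] in_cell[OF P'(3)]
  have "{} \<notin> P"
    using partition_onD3[OF P'(3)] .
  \<comment> \<open>Different cells with equal coarse label force the label \<open>{}\<close>, so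
    both points lie in compact sets, at distance at least \<open>e\<close>.\<close>
  have det: "?f x = ?f y" if "?g x = ?g y" "dist x y < e" for x y
  proof (rule ccontr)
    assume ne: "?f x \<noteq> ?f y"
    then have "x \<in> K (?f x)" "y \<in> K (?f y)"
      using that(1) cell \<open>{} \<notin> P\<close> by (auto simp: coarse_cell_def split: if_splits)
    then show False
      using e(2)[OF cell(1) cell(1) ne] that(2) by force
  qed
  have "\<exists>J n B. thrifty_cover F ?f ?g s N \<delta> J n B" if \<delta>: "0 < \<delta>" for N \<delta>
  proof -
    \<comment> \<open>Radius \<open>e / 2\<close>, because two points of a Bowen ball then stay
      within \<open>e\<close> of each other along its tile.\<close>
    from bowen_entropy_cover[OF card s half_gt_zero[OF e(1)] \<delta>, of N]
    obtain I :: "nat set" and n x where I: "\<forall>i\<in>I. N \<le> n i"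
      "Y \<subseteq> (\<Union>i\<in>I. bowen_ball \<phi> (F (n i)) (x i) (e / 2))"
      "\<forall>J. finite J \<longrightarrow> J \<subseteq> I \<longrightarrow> (\<Sum>i\<in>J. exp (- s * real (card (F (n i))))) \<le> \<delta>"
      by (elim exE conjE)
    define B where "B i = bowen_ball \<phi> (F (n i)) (x i) (e / 2)" for i
    have B: "B i \<in> events" for i
    proof -
      have "open (B i)"
        unfolding B_def by (rule open_bowen_ball[OF F.finite_F cont]) (use F.F_carrier in auto)
      then show ?thesis
        using borel by simp
    qed
    have UB: "(\<Union>i\<in>I. B i) \<in> events"
      using B by (intro sets.countable_UN') auto
    \<comment> \<open>\<open>Y\<close> is measurable for the completion; the open set covering it
      has the same measure there as under \<open>M\<close>.\<close>
    have "1 \<le> emeasure (completion M) (\<Union>i\<in>I. B i)"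
      using emeasure_mono[of Y "\<Union>i\<in>I. B i" "completion M"] I(2) UB Y(2) by (simp add: B_def)
    then have "1 \<le> prob (\<Union>i\<in>I. B i)"
      using UB by (simp add: emeasure_eq_measure)
    moreover obtain J where J: "finite J" "J \<subseteq> I" "prob (\<Union>i\<in>I. B i) - \<delta> \<le> prob (\<Union>i\<in>J. B i)"
      by (rule countable_union_finite_part[of I B \<delta>]) (use B \<delta> in auto)
    ultimately have "1 - \<delta> \<le> prob (\<Union>i\<in>J. B i)"
      by linarith
    moreover have "?f (\<phi> h y) = ?f (\<phi> h z)"
      if "y \<in> B i" "z \<in> B i" "h \<in> F (n i)" "?g (\<phi> h y) = ?g (\<phi> h z)" for i y z h
    proof (rule det[OF that(4)])
      have "dist (\<phi> h (x i)) (\<phi> h y) < e / 2" "dist (\<phi> h (x i)) (\<phi> h z) < e / 2"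
        using that(1-3) by (auto simp: B_def bowen_ball_def)
      then show "dist (\<phi> h y) (\<phi> h z) < e"
        using dist_triangle3[of "\<phi> h y" "\<phi> h z" "\<phi> h (x i)"] by linarith
    qed
    ultimately have "thrifty_cover F ?f ?g s N \<delta> J n B"
      unfolding thrifty_cover_def using I(1,3) J(1,2) B by blast
    then show ?thesis by blast
  qed
  then obtain W where W: "finite W" "W \<noteq> {}" "W \<subseteq> carrier G"
      "block_ent ?f W \<le> real (card W) * (ent ?g + s + \<kappa> / 2)"
    using block_ent_le_of_covers[OF F finite_valued_cell[OF P]
        finite_valued_coarse_cell[OF P K(2) K_events] s(1) half_gt_zero[OF \<kappa>]] by metis
  have "ent ?g \<le> \<kappa> / 2"
    using ent_coarse_cell_le[OF P K(2) K_events less_imp_le[OF K(3)] p(2)] small by linarith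
  then have "real (card W) * (ent ?g + s + \<kappa> / 2) \<le> real (card W) * (s + \<kappa>)"
    by (intro mult_left_mono) auto
  with W(4) have "block_ent ?f W \<le> real (card W) * (s + \<kappa>)"
    by (rule order_trans)
  moreover have "0 < real (card W)"
    using W by (simp add: card_gt_0_iff)
  ultimately have "block_ent ?f W / real (card W) \<le> s + \<kappa>"
    by (simp add: pos_divide_le_eq mult.commute)
  then show "partition_entropy M \<phi> F P \<le> s + \<kappa>"
    using partition_entropy_le[OF P F(2) W(1-3)] by linarith
qed

section \<open>Passage to the supremum over partitions\<close>

theorem theorem1p2:
  fixes G :: "('g, 'm) monoid_scheme"
    and \<phi> :: "'g \<Rightarrow> 'x::metric_space \<Rightarrow> 'x"
    and F :: "nat \<Rightarrow> 'g set"
    and \<mu> :: "'x measure"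
    and Y :: "'x set"
  assumes "countable (carrier G)"
    and "infinite (carrier G)"
    and "amenable G"
    and "compact (UNIV :: 'x set)"
    and "group_action G (UNIV :: 'x set) \<phi>"
    and "\<forall>g\<in>carrier G. continuous_on UNIV (\<phi> g)"
    and "folner_seq G F"
    and "tempered G F"
    and "filterlim (\<lambda>n. real (card (F n)) / ln (real n)) at_top sequentially"
    and "prob_space \<mu>"
    and "sets \<mu> = sets borel"
    and "\<forall>g\<in>carrier G. distr \<mu> \<mu> (\<phi> g) = \<mu>"
    and "Y \<in> sets (completion \<mu>)"
    and "emeasure (completion \<mu>) Y = 1"
  shows "measure_entropy \<mu> \<phi> F \<le> bowen_entropy \<phi> F Y"
proof -
  interpret prob_space \<mu> by fact
  have space: "space \<mu> = UNIV"
    using sets_eq_imp_space_eq[OF assms(11)] by simp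
  have act: "measure_preserving_action \<mu> G \<phi>"
  proof -
    have "\<phi> g \<in> measurable \<mu> \<mu>" if "g \<in> carrier G" for g
      unfolding measurable_cong_sets[OF assms(11) assms(11)]
      using assms(6) that by (intro borel_measurable_continuous_onI) simp
    then show ?thesis
      using assms(5,10,12) space
      by (intro measure_preserving_action.intro full_prob_space.intro full_prob_space_axioms.intro
          measure_preserving_action_axioms.intro) auto
  qed
  obtain C where C: "\<And>n. real (card (\<Union>k<n. (set_inv\<^bsub>G\<^esub> (F k)) <#>\<^bsub>G\<^esub> F n)) \<le> C * real (card (F n))"
    using assms(8) unfolding tempered_def by blast
  have tempered: "tempered_sequence G F (max C 0)"
  proof (intro tempered_sequence.intro tempered_sequence_axioms.intro)
    show "group G"
      using assms(5) unfolding group_action_def group_hom_def by blast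
    show "real (card (\<Union>k<n. (set_inv\<^bsub>G\<^esub> (F k)) <#>\<^bsub>G\<^esub> F n)) \<le> max C 0 * real (card (F n))" for n
      using C[of n] mult_right_mono[of C "max C 0" "real (card (F n))"] by simp
  qed (use assms(7) in \<open>auto simp: folner_seq_def\<close>)
  \<comment> \<open>\<open>card (F n)\<close> is eventually the given ratio times
    \<open>ln n\<close>, and both factors diverge; its divergence guarantees the critical value
    behind \<open>bowen_entropy\<close>.\<close>
  have card: "filterlim (\<lambda>n. card (F n)) at_top sequentially"
  proof -
    have "filterlim (\<lambda>n. real (card (F n)) / ln (real n) * ln (real n)) at_top sequentially"
      by (intro filterlim_at_top_mult_at_top[OF assms(9)] filterlim_compose[OF ln_at_top] filterlim_real_sequentially)
    moreover have "\<forall>\<^sub>F n in sequentially. real (card (F n)) / ln (real n) * ln (real n) = real (card (F n))"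
      using eventually_gt_at_top[of 1] by eventually_elim simp
    ultimately have "filterlim (\<lambda>n. real (card (F n))) at_top sequentially"
      by (rule filterlim_cong[OF refl refl, THEN iffD1, rotated])
    then have "\<forall>\<^sub>F n in sequentially. real Z \<le> real (card (F n))" for Z
      unfolding filterlim_at_top by blast
    then show ?thesis
      by (simp add: filterlim_at_top)
  qed
  show ?thesis
    unfolding measure_entropy_def
  proof (rule SUP_least)
    fix P assume P: "P \<in> {P. finite_measurable_partition \<mu> P}"
    show "ennreal (partition_entropy \<mu> \<phi> F P) \<le> bowen_entropy \<phi> F Y"
    \<comment> \<open>Testing against every \<open>q\<close> above the Bowen entropy provides, for
      finite \<open>q\<close>, a level \<open>s\<close> at which cheap covers exist;
      \<open>q = \<infinity>\<close> is trivial.\<close>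
    proof (rule dense_ge)
      fix q assume q: "bowen_entropy \<phi> F Y < q"
      show "ennreal (partition_entropy \<mu> \<phi> F P) \<le> q"
      proof (cases q)
        case (real s)
        have "partition_entropy \<mu> \<phi> F P \<le> s"
          by (rule partition_entropy_le_bowen[OF act assms(11,4) _ tempered assms(7) card assms(13,14)])
            (use P q real assms(6) in auto)
        then show ?thesis
          using real by (simp add: ennreal_leI)
      qed simp
    qed
  qed
qed

end
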